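(* For all integers $n\geq 0$, \[ \mathfrak{B}_5(10n+6)\equiv 0 \pmod 2 \qquad\text{and}\qquad \mathfrak{B}_5(10n+8)\equiv 0 \pmod 2 . \]
   Context: For $|q|<1$ write $(a;q)_\infty=\prod_{j=0}^{\infty}(1-aq^j)$. For an integer $k\geq 3$, $\mathfrak{B}_k(n)$ denotes the number of $k$ dots bracelet partitions of $n$; these integers are determined by the generating function \[ \sum_{n=0}^{\infty}\mathfrak{B}_{k}(n)q^n=\frac{(-q;q)_{\infty}}{(q;q)_{\infty}^{k-1}(-q^k;q^k)_{\infty}} . \] Here it is used with $k=5$. *)

theory Defs
  imports "HOL-Complex_Analysis.Complex_Analysis" "HOL-Number_Theory.Cong"
begin

definition qpoch :: "complex \<Rightarrow> complex \<Rightarrow> complex" where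
  "qpoch a q = (\<Prod>j. 1 - a * q ^ j)"

definition bracelet_gf :: "nat \<Rightarrow> complex \<Rightarrow> complex" where
  "bracelet_gf k q = qpoch (- q) q / (qpoch q q ^ (k - 1) * qpoch (- (q ^ k)) (q ^ k))"

text \<open>
  The integer coefficients of the power series that sums to the generating function on the whole
  open unit disc. Lemma \<open>dots_bracelet_ex1\<close> below shows that this description is proper for
  every \<open>k > 0\<close>; the combinatorial objects themselves require \<open>k \<ge> 3\<close>.
\<close>
definition dots_bracelet :: "nat \<Rightarrow> nat \<Rightarrow> int" where
  "dots_bracelet k = (THE B. \<forall>q. norm q < 1 \<longrightarrow> (\<lambda>n. of_int (B n) * q ^ n) sums bracelet_gf k q)"

text \<open>
  Functions on the open unit disc with an integral Taylor series at 0; used only to show that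
  \<open>dots_bracelet\<close> is well defined.
\<close>
definition int_series :: "(complex \<Rightarrow> complex) \<Rightarrow> bool" where
  "int_series f \<longleftrightarrow> f holomorphic_on ball 0 1 \<and> (\<forall>n. fps_nth (fps_expansion f 0) n \<in> \<int>)"

lemma int_series_expansion:
  assumes "int_series f"
  shows "f has_fps_expansion fps_expansion f 0"
  using assms unfolding int_series_def
  by (intro has_fps_expansion_fps_expansion[of "ball 0 1"]) auto

lemma int_seriesI:
  assumes "f holomorphic_on ball 0 1" "f has_fps_expansion F" "\<And>n. fps_nth F n \<in> \<int>"
  shows "int_series f"
  using assms fps_expansion_eqI[OF assms(2)] unfolding int_series_def by auto

lemma int_series_factor:
  assumes "s \<in> \<int>"
  shows "int_series (\<lambda>q. 1 - s * q ^ m * (q ^ m) ^ j)"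
proof (rule int_seriesI)
  show "(\<lambda>q. 1 - s * q ^ m * (q ^ m) ^ j) has_fps_expansion
          1 - fps_const s * fps_X ^ m * (fps_X ^ m) ^ j"
    by (intro fps_expansion_intros)
  have *: "(1 - fps_const s * fps_X ^ m * (fps_X ^ m) ^ j :: complex fps)
          = 1 - fps_const s * fps_X ^ (m + m * j)"
    by (simp add: power_add power_mult mult.assoc)
  show "fps_nth (1 - fps_const s * fps_X ^ m * (fps_X ^ m) ^ j) n \<in> \<int>" for n
    unfolding * using assms by simp
qed (intro holomorphic_intros)

lemma int_series_mult:
  assumes "int_series f" "int_series g"
  shows "int_series (\<lambda>q. f q * g q)"
proof (rule int_seriesI)
  show "(\<lambda>q. f q * g q) has_fps_expansion fps_expansion f 0 * fps_expansion g 0"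
    by (intro has_fps_expansion_mult int_series_expansion assms)
  show "fps_nth (fps_expansion f 0 * fps_expansion g 0) n \<in> \<int>" for n
    using assms unfolding int_series_def fps_mult_nth by (intro Ints_sum Ints_mult) auto
  show "(\<lambda>q. f q * g q) holomorphic_on ball 0 1"
    using assms unfolding int_series_def by (intro holomorphic_intros) auto
qed

lemma int_series_1: "int_series (\<lambda>_. 1)"
  using int_series_factor[of 0 0 0] by simp

lemma int_series_power:
  assumes "int_series f"
  shows "int_series (\<lambda>q. f q ^ n)"
  by (induction n) (use int_series_mult[OF assms] int_series_1 in auto)

lemma int_series_prod:
  assumes "\<And>j. int_series (f j)"
  shows "int_series (\<lambda>q. \<Prod>j<(n::nat). f j q)"
  by (induction n) (use int_series_mult assms int_series_1 in \<open>auto simp: mult.commute\<close>)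

lemma int_series_inverse:
  assumes f: "int_series f" and 0: "f 0 = 1" and nz: "\<And>q. norm q < 1 \<Longrightarrow> f q \<noteq> 0"
  shows "int_series (\<lambda>q. inverse (f q))"
proof (rule int_seriesI)
  define F where "F = fps_expansion f 0"
  have F0: "fps_nth F 0 = 1"
    using 0 by (simp add: F_def fps_expansion_def)
  show "(\<lambda>q. inverse (f q)) has_fps_expansion inverse F"
    unfolding F_def using f F0
    by (intro has_fps_expansion_inverse int_series_expansion) (auto simp: F_def)
  show "fps_nth (inverse F) n \<in> \<int>" for n
  proof (induction n rule: less_induct)
    case (less n)
    show ?case
    proof (cases "n = 0")
      case True
      thus ?thesis using F0 by simp
    next
      case False
      have "fps_nth (inverse F) n = - (\<Sum>i=1..n. fps_nth F i * fps_nth (inverse F) (n - i))"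
      proof -
        have "F * inverse F = 1" using F0 by (intro inverse_mult_eq_1') auto
        hence "fps_nth (F * inverse F) n = 0" using False by simp
        thus ?thesis
          using F0 by (simp add: fps_mult_nth sum.atLeast_Suc_atMost eq_neg_iff_add_eq_0)
      qed
      also have "\<dots> \<in> \<int>"
        using less f unfolding F_def int_series_def
        by (intro Ints_minus Ints_sum Ints_mult) auto
      finally show ?thesis .
    qed
  qed
  show "(\<lambda>q. inverse (f q)) holomorphic_on ball 0 1"
    using f nz unfolding int_series_def by (intro holomorphic_intros) auto
qed

lemma int_series_limit:
  assumes f: "\<And>n::nat. int_series (f n)"
    and lim: "\<And>r. 0 < r \<Longrightarrow> r < 1 \<Longrightarrow> uniform_limit (cball 0 r) f g sequentially"
  shows "int_series g"
proof -
  have hol: "g holomorphic_on ball 0 r" if "0 < r" "r < 1" for r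
  proof (rule holomorphic_uniform_limit[OF _ lim[OF that]])
    show "\<forall>\<^sub>F n in sequentially. continuous_on (cball 0 r) (f n) \<and> f n holomorphic_on ball 0 r"
    proof (intro always_eventually allI conjI)
      fix n
      have "f n holomorphic_on ball 0 1" using f by (auto simp: int_series_def)
      thus "continuous_on (cball 0 r) (f n)" "f n holomorphic_on ball 0 r"
        using that by (auto intro!: holomorphic_on_imp_continuous_on elim!: holomorphic_on_subset)
    qed
  qed auto
  have "g analytic_on {z}" if "norm z < 1" for z
  proof -
    obtain r where "norm z < r" "r < 1" using \<open>norm z < 1\<close> dense by blast
    moreover from this have "0 < r" using norm_ge_zero[of z] by linarith
    ultimately show ?thesis
      using hol[of r] by (auto intro!: analytic_at_ball holomorphic_on_imp_analytic_at)
  qed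
  hence "g analytic_on ball 0 1" by (subst analytic_on_analytic_at) auto
  hence g: "g holomorphic_on ball 0 1" by (rule analytic_imp_holomorphic)
  have u: "uniform_limit (ball 0 (1/2)) f g sequentially"
    by (rule uniform_limit_on_subset[OF lim[of "1/2"]]) auto
  have "(\<lambda>n. (deriv ^^ m) (f n) 0 / fact m) \<longlonglongrightarrow> (deriv ^^ m) g 0 / fact m" for m
  proof (intro tendsto_divide higher_deriv_complex_uniform_limit[OF u] always_eventually allI)
    show "f n holomorphic_on ball 0 (1/2)" for n
      using f[of n] unfolding int_series_def by (auto elim!: holomorphic_on_subset)
  qed auto
  hence "(deriv ^^ m) g 0 / fact m \<in> \<int>" for m
    using f by (rule_tac Lim_in_closed_set[where F = sequentially and
        f = "\<lambda>n. (deriv ^^ m) (f n) 0 / fact m", OF closed_Ints])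
      (auto simp: int_series_def fps_expansion_def)
  thus ?thesis
    using g by (simp add: int_series_def fps_expansion_def)
qed

lemma qpoch_factors_uniform:
  fixes s :: complex
  assumes s: "norm s = 1" and m: "m > 0" and r: "0 < r" "r < 1"
  shows "uniformly_convergent_on (cball 0 r) (\<lambda>N q. \<Sum>j<N. norm (1 - s * q ^ m * (q ^ m) ^ j - 1))"
proof (rule Weierstrass_m_test'_ev)
  show "\<forall>\<^sub>F n in sequentially. \<forall>x\<in>cball 0 r. norm (norm (1 - s * x ^ m * (x ^ m) ^ n - 1)) \<le> r ^ n"
  proof (intro always_eventually allI ballI)
    fix n and x :: complex assume "x \<in> cball 0 r"
    hence x: "norm x \<le> r" by simp
    have "norm (norm (1 - s * x ^ m * (x ^ m) ^ n - 1)) = norm x ^ (m + m * n)"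
      using s by (simp add: norm_mult norm_power power_add power_mult)
    also have "\<dots> \<le> r ^ (m + m * n)" using x by (intro power_mono) auto
    also have "\<dots> \<le> r ^ n" using r m by (intro power_decreasing) (auto simp: trans_le_add2)
    finally show "norm (norm (1 - s * x ^ m * (x ^ m) ^ n - 1)) \<le> r ^ n" .
  qed
  show "summable (\<lambda>n. r ^ n)" using r by (intro summable_geometric) auto
qed

lemma qpoch_factor_nz:
  fixes s :: complex
  assumes s: "norm s = 1" and m: "m > 0" and q: "norm q < 1"
  shows "1 - s * q ^ m * (q ^ m) ^ j \<noteq> 0"
proof
  assume "1 - s * q ^ m * (q ^ m) ^ j = 0"
  hence "norm (s * q ^ m * (q ^ m) ^ j) = 1" by simp
  hence "norm q ^ (m + m * j) = 1"
    using s by (simp add: norm_mult norm_power power_add power_mult)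
  moreover have "norm q ^ (m + m * j) < 1"
    using q m by (intro power_less_one_iff[THEN iffD2]) auto
  ultimately show False by simp
qed

lemma qpoch_convergent:
  fixes s :: complex
  assumes s: "norm s = 1" and m: "m > 0" and q: "norm q < 1"
  shows "convergent_prod (\<lambda>j. 1 - s * q ^ m * (q ^ m) ^ j)"
proof (rule abs_convergent_prod_imp_convergent_prod,
       subst abs_convergent_prod_conv_summable)
  have "norm (q ^ m) < 1" using q m by (simp add: norm_power power_less_one_iff)
  thus "summable (\<lambda>j. norm (1 - s * q ^ m * (q ^ m) ^ j - 1))"
    using s by (simp add: norm_mult norm_power summable_mult)
qed

lemma qpoch_nz:
  fixes s :: complex
  assumes "norm s = 1" "m > 0" "norm q < 1"
  shows "qpoch (s * q ^ m) (q ^ m) \<noteq> 0"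
  unfolding qpoch_def
  by (rule prodinf_nonzero[OF qpoch_convergent[OF assms] qpoch_factor_nz[OF assms]])

lemma qpoch_int_series:
  fixes s :: complex
  assumes s: "norm s = 1" "s \<in> \<int>" and m: "m > 0"
  shows "int_series (\<lambda>q. qpoch (s * q ^ m) (q ^ m))"
proof (rule int_series_limit)
  show "int_series (\<lambda>q. \<Prod>j<n. 1 - s * q ^ m * (q ^ m) ^ j)" for n
    by (intro int_series_prod int_series_factor s)
  fix r :: real assume r: "0 < r" "r < 1"
  have "uniformly_convergent_on (cball 0 r) (\<lambda>N q. \<Prod>j<N. 1 - s * q ^ m * (q ^ m) ^ j)"
    by (intro uniformly_convergent_on_prod' qpoch_factors_uniform s m r) (auto intro!: continuous_intros)
  then obtain l where l: "uniform_limit (cball 0 r) (\<lambda>N q. \<Prod>j<N. 1 - s * q ^ m * (q ^ m) ^ j) l sequentially"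
    by (auto simp: uniformly_convergent_on_def)
  have "l q = qpoch (s * q ^ m) (q ^ m)" if "q \<in> cball 0 r" for q
  proof (rule LIMSEQ_unique)
    show "(\<lambda>N. \<Prod>j<N. 1 - s * q ^ m * (q ^ m) ^ j) \<longlonglongrightarrow> l q"
      using tendsto_uniform_limitI[OF l that] .
    have "norm q < 1" using that r by simp
    hence "convergent_prod (\<lambda>j. 1 - s * q ^ m * (q ^ m) ^ j)"
      by (rule qpoch_convergent[OF s(1) m])
    hence "(\<lambda>N. \<Prod>j\<le>N. 1 - s * q ^ m * (q ^ m) ^ j) \<longlonglongrightarrow> qpoch (s * q ^ m) (q ^ m)"
      unfolding qpoch_def by (rule convergent_prod_LIMSEQ)
    thus "(\<lambda>N. \<Prod>j<N. 1 - s * q ^ m * (q ^ m) ^ j) \<longlonglongrightarrow> qpoch (s * q ^ m) (q ^ m)"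
      by (simp add: LIMSEQ_lessThan_iff_atMost)
  qed
  with l show "uniform_limit (cball 0 r) (\<lambda>N q. \<Prod>j<N. 1 - s * q ^ m * (q ^ m) ^ j)
                 (\<lambda>q. qpoch (s * q ^ m) (q ^ m)) sequentially"
    by (subst uniform_limit_cong'[where g = "\<lambda>N q. \<Prod>j<N. 1 - s * q ^ m * (q ^ m) ^ j" and i = l]) auto
qed

lemma qpoch_0: "m > 0 \<Longrightarrow> qpoch (s * 0 ^ m) (0 ^ m) = 1"
  by (simp add: qpoch_def power_0_left)

lemma bracelet_gf_int_series:
  assumes k: "k > 0"
  shows "int_series (bracelet_gf k)"
proof -
  define D where
    "D = (\<lambda>q::complex. qpoch (1 * q ^ 1) (q ^ 1) ^ (k - 1) * qpoch ((-1) * q ^ k) (q ^ k))"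
  have "int_series D"
    unfolding D_def by (intro int_series_mult int_series_power qpoch_int_series k) auto
  moreover have "D 0 = 1"
    unfolding D_def by (subst (1 2) qpoch_0) (use k in auto)
  moreover have "D q \<noteq> 0" if "norm q < 1" for q
    using qpoch_nz[of 1 1 q] qpoch_nz[of "-1" k q] k that by (simp add: D_def)
  ultimately have "int_series (\<lambda>q. inverse (D q))"
    by (rule int_series_inverse)
  moreover have "int_series (\<lambda>q. qpoch ((-1) * q ^ 1) (q ^ 1))"
    by (intro qpoch_int_series) auto
  ultimately have "int_series (\<lambda>q. qpoch ((-1) * q ^ 1) (q ^ 1) * inverse (D q))"
    by (intro int_series_mult)
  also have "(\<lambda>q. qpoch ((-1) * q ^ 1) (q ^ 1) * inverse (D q)) = bracelet_gf k"
    by (simp add: bracelet_gf_def D_def field_simps fun_eq_iff)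
  finally show ?thesis .
qed

lemma dots_bracelet_ex1:
  assumes k: "k > 0"
  shows "\<exists>!B. \<forall>q. norm q < 1 \<longrightarrow> (\<lambda>n. of_int (B n) * q ^ n) sums bracelet_gf k q"
proof -
  have *: "int_series (bracelet_gf k)" using k by (rule bracelet_gf_int_series)
  define F where "F = fps_expansion (bracelet_gf k) 0"
  have "\<forall>n. \<exists>b::int. fps_nth F n = of_int b"
    using * unfolding int_series_def F_def by (metis Ints_cases)
  then obtain B :: "nat \<Rightarrow> int" where B: "\<And>n. fps_nth F n = of_int (B n)"
    by metis
  show ?thesis
  proof (rule ex1I[of _ B]; safe?)
    fix q :: complex assume "norm q < 1"
    hence "(\<lambda>n. fps_nth F n * q ^ n) sums bracelet_gf k q"
      using * int_series_expansion[OF *]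
      by (intro has_fps_expansion_imp_sums_complex[where r = 1])
         (auto simp: F_def int_series_def one_ereal_def)
    thus "(\<lambda>n. of_int (B n) * q ^ n) sums bracelet_gf k q" by (simp add: B)
  next
    fix C :: "nat \<Rightarrow> int"
    assume C: "\<forall>q. norm q < 1 \<longrightarrow> (\<lambda>n. of_int (C n) * q ^ n) sums bracelet_gf k q"
    have "\<forall>\<^sub>F q in nhds 0. q \<in> ball (0::complex) 1"
      by (intro eventually_nhds_in_open) auto
    hence "bracelet_gf k has_fps_expansion Abs_fps (\<lambda>n. of_int (C n))"
      using C by (intro has_fps_expansionI) (auto elim!: eventually_mono)
    hence "Abs_fps (\<lambda>n. of_int (C n)) = F"
      unfolding F_def using int_series_expansion[OF *] by (rule fps_expansion_unique_complex)
    hence "of_int (C n) = (of_int (B n) :: complex)" for n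
      using B[of n] by (metis fps_nth_Abs_fps)
    thus "C = B" by auto
  qed
qed

lemma dots_bracelet_sums:
  assumes "k > 0" "norm q < 1"
  shows "(\<lambda>n. of_int (dots_bracelet k n) * q ^ n) sums bracelet_gf k q"
  using theI'[OF dots_bracelet_ex1[OF assms(1)]] assms(2) unfolding dots_bracelet_def by blast

end

theory Submission
  imports Defs "HOL-Library.Z2"
begin

text \<open>
  Work with power series over the field with two elements and write $f_k = \prod_{n\ge 1}(1+X^{kn})$.
  There the signs in the generating function disappear, and with $b$ the reduction of the series of
  the bracelet numbers for $k = 5$, the definition becomes $b f_1^4 f_5 = f_1$, that is
  $b f_1^3 f_5 = 1$. Multiplying by $f_1 f_5$ gives
  \[ b \, (f_1^2 f_5)^2 = f_1 f_5 . \]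
  In characteristic 2 a square is a series in $X^2$, so the even part $E$ of $b$ (the series of the
  coefficients at even exponents) satisfies
  \[ E \, f_1^2 f_5 = \mbox{even part of } f_1 f_5 . \]

  The crucial point is that the even part of $f_1 f_5$ is $f_1^3$. By the Jacobi triple product, modulo 2
  and for the moduli 5 and 4,
  \[ f_1 f_5 = \Big(\sum_k X^{(5k^2-3k)/2}\Big)\Big(\sum_l X^{(5l^2-l)/2}\Big), \qquad
     f_1^3 = \sum_k X^{2k^2-k} , \]
  so the claim is that the number of $(k,l)$ with $5k^2-3k+5l^2-l = 4n$ is odd exactly if
  $8n+1$ is a square. With $s = 4k-2l-1$, $t = 2k+4l-1$ these pairs become the representations
  $16n+2 = s^2+t^2$ by odd $s, t$ with $2s+t \equiv 2$ modulo 5, which are a quarter of those with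
  $2s+t$ prime to 5 (multiply $s+it$ by $i$). Since $5 \mid 2s+t$ means that $s+it$ is divisible by the
  Gaussian prime $2+i$, multiplication by its conjugate lets all factors 5 be removed from the number
  represented; and for a number prime to 5 the changes of sign and the exchange of $s$ and $t$ leave,
  modulo 8, only the representations with $|s| = |t|$. Lemma \<open>odd_card_quadratic_reps\<close> is the result,
  and \<open>even_part_theta\<close> its translation back to series.

  Cancelling $f_1^2$ leaves $E f_5 = f_1 = \sum_k X^{(3k^2-k)/2}$ (\<open>even_part_bracelet\<close>). Now $f_5$ is a
  series in $X^5$ and pentagonal numbers are 0, 1 or 2 modulo 5, so $E$ has no coefficient at exponents
  that are 3 or 4 modulo 5. These exponents $5n+3$ and $5n+4$ of $E$ are $10n+6$ and $10n+8$ in $b$.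
\<close>

unbundle no vec_syntax

section \<open>Power series over the field with two elements\<close>

text \<open>
  The default simplification of the ring operations on \<open>bit\<close> to bitwise connectives would
  destroy the ring structure that the arguments below depend on.
\<close>
declare add_bit_eq_xor [simp del] mult_bit_eq_and [simp del]

lemma bit_fps_add_self [simp]: "F + F = (0 :: bit fps)"
  by (simp add: fps_eq_iff)

lemma bit_fps_diff: "F - G = F + (G :: bit fps)"
proof -
  have "F - G = F - G + (G + G)" by (simp only: bit_fps_add_self add_0_right)
  then show ?thesis by simp
qed

lemma bit_fps_power2_add: "(F + G)\<^sup>2 = F\<^sup>2 + (G\<^sup>2 :: bit fps)"
proof -
  have "(F + G)\<^sup>2 = F\<^sup>2 + G\<^sup>2 + (F * G + F * G)"
    by (simp only: power2_eq_square ring_distribs mult.commute add_ac)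
  then show ?thesis by (simp only: bit_fps_add_self add_0_right)
qed

text \<open>
  Congruence modulo $X^d$. All infinite products and sums are compared through their finite
  truncations, which determine them modulo every power of $X$.
\<close>
definition agree :: "nat \<Rightarrow> 'a::comm_ring_1 fps \<Rightarrow> 'a fps \<Rightarrow> bool" where
  "agree d F G \<longleftrightarrow> (\<forall>i<d. F $ i = G $ i)"

lemma agree_refl [simp]: "agree d F F" by (simp add: agree_def)
lemma agree_sym: "agree d F G \<Longrightarrow> agree d G F" by (simp add: agree_def)
lemma agree_trans [trans]: "agree d F G \<Longrightarrow> agree d G H \<Longrightarrow> agree d F H" by (simp add: agree_def)
lemma agree_mono: "agree d F G \<Longrightarrow> d' \<le> d \<Longrightarrow> agree d' F G" by (simp add: agree_def)
lemma agree_mult: "agree d F G \<Longrightarrow> agree d F' G' \<Longrightarrow> agree d (F * F') (G * G')"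
  by (auto simp: agree_def fps_mult_nth intro!: sum.cong)
lemma agree_sum: "(\<And>x. x \<in> S \<Longrightarrow> agree d (f x) (g x)) \<Longrightarrow> agree d (sum f S) (sum g S)"
  by (auto simp: agree_def fps_sum_nth intro!: sum.cong)
lemma agree_prod: "(\<And>x. x \<in> S \<Longrightarrow> agree d (f x) (g x)) \<Longrightarrow> agree d (prod f S) (prod g S)"
  by (induction S rule: infinite_finite_induct) (auto intro!: agree_mult)
lemma agree_eqI: "(\<And>d. agree d F G) \<Longrightarrow> F = G"
  by (auto simp: agree_def fps_eq_iff)
lemma agree_X_power: "d \<le> k \<Longrightarrow> agree d (F * fps_X ^ k) 0"
  by (auto simp: agree_def fps_X_power_mult_right_nth)

text \<open>
  Squaring is additive in characteristic 2 and fixes the coefficients, so $F(X)^2 = F(X^2)$.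
\<close>
lemma bit_fps_square_nth: "(F ^ 2) $ n = (if even n then F $ (n div 2) else (0 :: bit))"
proof -
  define S where "S = (\<Sum>i<Suc n. fps_const (F $ i) * fps_X ^ i)"
  have coeff: "S $ j = F $ j" if "j \<le> n" for j
    using that by (simp add: S_def fps_sum_nth fps_X_power_nth if_distrib cong: if_cong del: sum.lessThan_Suc)
  have "agree (Suc n) F S" using coeff by (simp add: agree_def)
  then have "agree (Suc n) (F ^ 2) (S ^ 2)" unfolding power2_eq_square by (intro agree_mult)
  moreover have "(\<Sum>i<N. fps_const (F $ i) * fps_X ^ i) ^ 2 = (\<Sum>i<N. fps_const (F $ i) * fps_X ^ (2 * i))" for N
  proof (induction N)
    case (Suc N)
    have "fps_const (F $ N) ^ 2 = fps_const (F $ N)" by (cases "F $ N") simp_all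
    then show ?case using Suc.IH
      by (simp add: bit_fps_power2_add power_mult_distrib power_even_eq flip: power_mult)
  qed simp
  ultimately have "(F ^ 2) $ n = (\<Sum>i<Suc n. fps_const (F $ i) * fps_X ^ (2 * i)) $ n"
    by (simp add: agree_def S_def del: sum.lessThan_Suc)
  also have "\<dots> = (\<Sum>i<Suc n. if n = 2 * i then F $ i else 0)"
    unfolding fps_sum_nth by (rule sum.cong) (auto simp: fps_X_power_nth)
  also have "\<dots> = (if even n then F $ (n div 2) else 0)"
  proof (cases "even n")
    case True
    then obtain j where "n = 2 * j" by blast
    then show ?thesis by (simp del: sum.lessThan_Suc)
  next
    case False
    then have "n \<noteq> 2 * i" for i by auto
    then show ?thesis using False by simp
  qed
  finally show ?thesis .
qed

definition even_part :: "'a::comm_ring_1 fps \<Rightarrow> 'a fps" where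
  "even_part F = Abs_fps (\<lambda>n. F $ (2 * n))"

text \<open>
  A square is a series in $X^2$, and multiplication by such a series respects the decomposition
  into even and odd exponents.
\<close>
lemma even_part_mult_square: "even_part (F * K ^ 2) = even_part F * (K :: bit fps)"
proof (rule fps_ext)
  fix n
  have "even_part (F * K ^ 2) $ n = (\<Sum>i\<in>{0..2 * n}. F $ i * (K ^ 2) $ (2 * n - i))"
    by (simp add: even_part_def fps_mult_nth)
  also have "\<dots> = (\<Sum>i\<in>(\<lambda>j. 2 * j) ` {0..n}. F $ i * (K ^ 2) $ (2 * n - i))"
  proof (rule sum.mono_neutral_right)
    show "\<forall>i\<in>{0..2 * n} - (\<lambda>j. 2 * j) ` {0..n}. F $ i * (K ^ 2) $ (2 * n - i) = 0"
    proof
      fix i assume i: "i \<in> {0..2 * n} - (\<lambda>j. 2 * j) ` {0..n}"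
      have "odd i"
      proof
        assume "even i"
        then obtain j where "i = 2 * j" by blast
        then show False using i by auto
      qed
      then have "odd (2 * n - i)" using i by simp
      then show "F $ i * (K ^ 2) $ (2 * n - i) = 0" by (simp add: bit_fps_square_nth)
    qed
  qed auto
  also have "\<dots> = (\<Sum>j\<in>{0..n}. F $ (2 * j) * K $ (n - j))"
    by (subst sum.reindex) (auto simp: inj_on_def bit_fps_square_nth simp flip: diff_mult_distrib2 intro!: sum.cong)
  also have "\<dots> = (even_part F * K) $ n"
    by (simp add: even_part_def fps_mult_nth)
  finally show "even_part (F * K ^ 2) $ n = (even_part F * K) $ n" .
qed

section \<open>Products of the factors $1 + X^n$\<close>

text \<open>
  The infinite product $\prod_{n\in A,\, n>0}(1+X^n)$. Factors with $k > n$ do not influence the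
  coefficient at $X^n$. Products over multiples, residue classes and their combinations are all of this
  form, and modulo 2 this covers the factors $1 - X^n$ as well.
\<close>
definition dprod :: "nat set \<Rightarrow> bit fps" where
  "dprod A = Abs_fps (\<lambda>n. (\<Prod>k\<in>A \<inter> {1..n}. 1 + fps_X ^ k) $ n)"

lemma agree_dprod:
  assumes "finite B" "A \<inter> {1..<N} \<subseteq> B" "B \<subseteq> A - {0}"
  shows "agree N (dprod A) (\<Prod>k\<in>B. 1 + fps_X ^ k)"
  unfolding agree_def
proof (intro allI impI)
  fix i assume "i < N"
  define C where "C = A \<inter> {1..i}"
  have sub: "C \<subseteq> B" using assms \<open>i < N\<close> by (auto simp: C_def)
  have "agree (Suc i) (\<Prod>k\<in>B - C. 1 + fps_X ^ k) (\<Prod>k\<in>B - C. 1 :: bit fps)"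
    using assms by (intro agree_prod) (auto simp: agree_def C_def)
  then have "agree (Suc i) ((\<Prod>k\<in>B - C. 1 + fps_X ^ k) * (\<Prod>k\<in>C. 1 + fps_X ^ k)) (1 * (\<Prod>k\<in>C. 1 + fps_X ^ k :: bit fps))"
    by (intro agree_mult) auto
  then show "dprod A $ i = (\<Prod>k\<in>B. 1 + fps_X ^ k) $ i"
    using prod.subset_diff[OF sub \<open>finite B\<close>, of "\<lambda>k. 1 + fps_X ^ k :: bit fps"]
    by (simp add: dprod_def C_def agree_def)
qed

lemma agree_dprod_le: "agree (Suc N) (dprod A) (\<Prod>k\<in>A \<inter> {1..N}. 1 + fps_X ^ k)"
  by (rule agree_dprod) auto

lemma dprod_nth_0 [simp]: "dprod A $ 0 = 1"
  by (simp add: dprod_def)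

lemma dprod_nonzero [simp]: "dprod A \<noteq> 0"
  using dprod_nth_0[of A] by (metis fps_zero_nth zero_neq_one)

lemma dprod_mult: "dprod A * dprod B = dprod (A \<union> B) * dprod (A \<inter> B)"
proof (rule agree_eqI)
  fix d
  let ?p = "\<lambda>A. \<Prod>k\<in>A \<inter> {1..d}. 1 + fps_X ^ k :: bit fps"
  have "agree (Suc d) (dprod A * dprod B) (?p A * ?p B)"
    by (intro agree_mult agree_dprod_le)
  also have "?p A * ?p B = ?p (A \<union> B) * ?p (A \<inter> B)"
    using prod.union_inter[of "A \<inter> {1..d}" "B \<inter> {1..d}" "\<lambda>k. 1 + fps_X ^ k :: bit fps"]
    by (simp add: Int_Un_distrib2 Int_ac)
  also have "agree (Suc d) \<dots> (dprod (A \<union> B) * dprod (A \<inter> B))"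
    by (intro agree_mult agree_sym[OF agree_dprod_le])
  finally show "agree d (dprod A * dprod B) (dprod (A \<union> B) * dprod (A \<inter> B))"
    by (rule agree_mono) simp
qed

lemma dprod_empty [simp]: "dprod {} = 1"
  by (simp add: dprod_def fps_eq_iff)

lemma dprod_Un_disjoint: "A \<inter> B = {} \<Longrightarrow> dprod (A \<union> B) = dprod A * dprod B"
  by (simp add: dprod_mult)

text \<open>
  Over the field with two elements $(1+X^k)^2 = 1+X^{2k}$.
\<close>
lemma dprod_square: "dprod A ^ 2 = dprod ((\<lambda>k. 2 * k) ` A)"
proof (rule agree_eqI)
  fix d
  let ?B = "A \<inter> {1..d}"
  have "agree (Suc d) (dprod A ^ 2) ((\<Prod>k\<in>?B. 1 + fps_X ^ k) ^ 2)"
    unfolding power2_eq_square by (intro agree_mult agree_dprod_le)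
  also have "(\<Prod>k\<in>?B. 1 + fps_X ^ k :: bit fps) ^ 2 = (\<Prod>k\<in>?B. 1 + fps_X ^ (2 * k))"
    by (simp add: prod_power_distrib bit_fps_power2_add power_mult mult.commute flip: power_mult)
  also have "\<dots> = (\<Prod>k\<in>(\<lambda>k. 2 * k) ` ?B. 1 + fps_X ^ k)"
    by (simp add: prod.reindex inj_on_def)
  also have "agree (Suc d) \<dots> (dprod ((\<lambda>k. 2 * k) ` A))"
    by (intro agree_sym[OF agree_dprod]) auto
  finally show "agree d (dprod A ^ 2) (dprod ((\<lambda>k. 2 * k) ` A))"
    by (rule agree_mono) simp
qed

section \<open>Theta series and the Jacobi triple product modulo 2\<close>

text \<open>
  The exponents $m\binom{k}{2}+ak$ of Ramanujan's theta function $f(X^a, X^{m-a})$, whose reduction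
  modulo 2 is \<open>theta m a\<close>.
\<close>
definition theta_exponent :: "nat \<Rightarrow> nat \<Rightarrow> int \<Rightarrow> nat" where
  "theta_exponent m a k = nat (int m * (k * (k - 1) div 2) + int a * k)"

definition theta :: "nat \<Rightarrow> nat \<Rightarrow> bit fps" where
  "theta m a = Abs_fps (\<lambda>n. of_nat (card {k. theta_exponent m a k = n}))"

text \<open>
  Each value is taken only finitely often, and only at small $k$; this makes the theta series well
  defined and lets it be truncated.
\<close>
lemma theta_exponent_ge:
  assumes "0 < a" "a < m"
  shows "\<bar>k\<bar> \<le> int m * (k * (k - 1) div 2) + int a * k"
proof -
  have *: "2 * (k * (k - 1) div 2) = k * (k - 1)" by simp
  show ?thesis
  proof (cases "k \<ge> 0")
    case True
    have "0 \<le> k * (k - 1)" using True by (cases "k = 0") auto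
    then have "0 \<le> int m * (k * (k - 1) div 2)" by auto
    moreover have "1 * k \<le> int a * k" using assms True by (intro mult_right_mono) auto
    ultimately show ?thesis using True by auto
  next
    case False
    have "0 \<le> (k + 1) * k" using False by (intro mult_nonpos_nonpos) auto
    then have "- k \<le> k * (k - 1) div 2" using * by (auto simp: algebra_simps)
    then have "int m * (- k) \<le> int m * (k * (k - 1) div 2)" by (rule mult_left_mono) auto
    moreover have "(int m - int a) * (-k) \<ge> 1 * (- k)" using False assms by (intro mult_right_mono) auto
    ultimately show ?thesis using False by (auto simp: algebra_simps)
  qed
qed

lemma int_theta_exponent:
  assumes "0 < a" "a < m"
  shows "int (theta_exponent m a k) = int m * (k * (k - 1) div 2) + int a * k"
  using order_trans[OF abs_ge_zero theta_exponent_ge[OF assms, of k]] by (simp add: theta_exponent_def)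

lemma abs_le_theta_exponent:
  assumes "0 < a" "a < m"
  shows "\<bar>k\<bar> \<le> int (theta_exponent m a k)"
  using theta_exponent_ge[OF assms] by (simp add: int_theta_exponent[OF assms])

lemma theta_exponent_step:
  assumes "0 < a" "a < m"
  shows "int (theta_exponent m a (k + 1)) = int (theta_exponent m a k) + int m * k + int a"
proof -
  have *: "(k + 1) * (k + 1 - 1) = k * (k - 1) + k * 2" by (simp add: algebra_simps)
  have "(k + 1) * (k + 1 - 1) div 2 = k * (k - 1) div 2 + k"
    by (subst *) simp
  then show ?thesis unfolding int_theta_exponent[OF assms] by (simp add: algebra_simps)
qed

lemma theta_exponent_double:
  assumes "0 < a" "a < m"
  shows "2 * int (theta_exponent m a k) = int m * (k * (k - 1)) + 2 * int a * k"
proof -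
  have "2 * (k * (k - 1) div 2) = k * (k - 1)" by simp
  then show ?thesis unfolding int_theta_exponent[OF assms] by (simp add: algebra_simps)
qed

lemma finite_theta_exponent:
  assumes "0 < a" "a < m"
  shows "finite {k. theta_exponent m a k = n}"
proof (rule finite_subset)
  show "{k. theta_exponent m a k = n} \<subseteq> {- int n..int n}"
  proof
    fix k assume k: "k \<in> {k. theta_exponent m a k = n}"
    have "\<bar>k\<bar> \<le> int n" using abs_le_theta_exponent[OF assms, of k] k by simp
    then show "k \<in> {- int n..int n}" by auto
  qed
qed simp

lemma theta_mult_nth:
  assumes "0 < a" "a < m" "0 < a'" "a' < m'"
  shows "(theta m a * theta m' a') $ n = of_nat (card {(k, l). theta_exponent m a k + theta_exponent m' a' l = n})"
proof -
  let ?A = "\<lambda>i. {k. theta_exponent m a k = i} \<times> {l. theta_exponent m' a' l = n - i}"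
  have "{(k, l). theta_exponent m a k + theta_exponent m' a' l = n} = (\<Union>i\<in>{0..n}. ?A i)"
    by auto
  also have "card \<dots> = (\<Sum>i\<in>{0..n}. card (?A i))"
    using finite_theta_exponent assms by (intro card_UN_disjoint) auto
  finally show ?thesis
    by (simp add: fps_mult_nth theta_def card_cartesian_product)
qed

text \<open>
  With $q = X^m$, \<open>qfact\<close> is $(q;q)_j$ modulo 2 and \<open>qbinom m n k\<close> is the Gaussian binomial
  coefficient ${2n \brack n+k}_q$. The value 0 of $1/(q;q)_j$ for negative $j$ is forced by the recursion
  $1/(q;q)_{j-1} = (1-q^j)/(q;q)_j$ at $j = 0$ and makes the coefficients vanish for $|k| > n$.
\<close>
definition qfact :: "nat \<Rightarrow> nat \<Rightarrow> bit fps" where "qfact m j = (\<Prod>i\<in>{1..j}. 1 + fps_X ^ (m * i))"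
definition inv_qfact :: "nat \<Rightarrow> int \<Rightarrow> bit fps" where
  "inv_qfact m j = (if j < 0 then 0 else inverse (qfact m (nat j)))"

lemma qfact_nth_0: "m > 0 \<Longrightarrow> qfact m j $ 0 = 1"
  unfolding qfact_def by (induction j) (simp_all add: prod.nat_ivl_Suc')
lemma qfact_Suc: "qfact m (Suc j) = (1 + fps_X ^ (m * Suc j)) * qfact m j"
  by (simp add: qfact_def prod.nat_ivl_Suc' mult.commute)

lemma qfact_inverse: "m > 0 \<Longrightarrow> qfact m j * inv_qfact m (int j) = 1"
  by (simp add: inv_qfact_def inverse_mult_eq_1' qfact_nth_0)

lemma inv_qfact_step:
  assumes "m > 0" "j \<ge> 0"
  shows "inv_qfact m (j - 1) = (1 + fps_X ^ (m * nat j)) * inv_qfact m j"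
proof (cases "j = 0")
  case True then show ?thesis by (simp add: inv_qfact_def)
next
  case False
  define i where "i = nat j - 1"
  have j: "j = int (Suc i)" using False assms by (simp add: i_def)
  have "inv_qfact m (j - 1) = inv_qfact m (int i) * (qfact m (Suc i) * inv_qfact m (int (Suc i)))"
    using qfact_inverse[OF \<open>m > 0\<close>, of "Suc i"] by (simp add: j)
  also have "\<dots> = (1 + fps_X ^ (m * Suc i)) * (qfact m i * inv_qfact m (int i)) * inv_qfact m j"
    by (simp add: qfact_Suc j mult_ac)
  finally show ?thesis using qfact_inverse[OF \<open>m > 0\<close>, of i] by (simp add: j del: of_nat_Suc)
qed

definition qbinom :: "nat \<Rightarrow> nat \<Rightarrow> int \<Rightarrow> bit fps" where
  "qbinom m n k = qfact m (2 * n) * inv_qfact m (int n + k) * inv_qfact m (int n - k)"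

lemma qbinom_outside: "\<not> (- int n \<le> k \<and> k \<le> int n) \<Longrightarrow> qbinom m n k = 0"
  by (auto simp: qbinom_def inv_qfact_def)

text \<open>
  Two steps of the $q$-Pascal recursion at once. After division by the common factor it is a polynomial
  identity in $a = q^{n+1-k}$, $b = q^{n+1+k}$, $A = q^{n-k}$, $B = q^{n+k}$ and $w = q^{2n+1}$, which in
  characteristic 2 follows from $aB = bA = w$ alone; the numerator $(q;q)_{2n+2}$
  supplies the factors $1-w$ and $1-ab$.
\<close>
lemma qbinom_Suc:
  assumes m: "m > 0" and k: "- int (Suc n) \<le> k" "k \<le> int (Suc n)"
  shows "qbinom m (Suc n) k = qbinom m n k * (1 + fps_X ^ (m * (2 * n + 1)))
           + qbinom m n (k - 1) * fps_X ^ (m * nat (int n + 1 - k))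
           + qbinom m n (k + 1) * fps_X ^ (m * nat (int n + 1 + k))"
proof -
  define a where "a = (fps_X ^ (m * nat (int n + 1 - k)) :: bit fps)"
  define b where "b = (fps_X ^ (m * nat (int n + 1 + k)) :: bit fps)"
  define A where "A = (fps_X ^ (m * nat (int n - k)) :: bit fps)"
  define B where "B = (fps_X ^ (m * nat (int n + k)) :: bit fps)"
  define w where "w = (fps_X ^ (m * (2 * n + 1)) :: bit fps)"
  define h where "h = inv_qfact m (int n + 1 + k)"
  define h' where "h' = inv_qfact m (int n + 1 - k)"
  have h1: "inv_qfact m (int n + k) = (1 + b) * h" "inv_qfact m (int n - k) = (1 + a) * h'"
    using inv_qfact_step[OF m, of "int n + 1 + k"] inv_qfact_step[OF m, of "int n + 1 - k"] k
    by (simp_all add: a_def b_def h_def h'_def algebra_simps)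
  \<comment> \<open>At the borders $k = \pm(n+1)$ the exponent of $A$ or $B$ would be negative, but the factor $1+a$ or $1+b$ next to it is then 0.\<close>
  have h2: "inv_qfact m (int n + (k - 1)) = (1 + B) * (1 + b) * h"
  proof (cases "int n + k \<ge> 0")
    case True
    then show ?thesis using inv_qfact_step[OF m, of "int n + k"] h1 by (simp add: B_def algebra_simps)
  next
    case False
    then have "b = 1" using k by (simp add: b_def)
    then show ?thesis using False by (simp add: inv_qfact_def)
  qed
  have h3: "inv_qfact m (int n - (k + 1)) = (1 + A) * (1 + a) * h'"
  proof (cases "int n - k \<ge> 0")
    case True
    then show ?thesis using inv_qfact_step[OF m, of "int n - k"] h1 by (simp add: A_def algebra_simps)
  next
    case False
    then have "a = 1" using k by (simp add: a_def)
    then show ?thesis using False by (simp add: inv_qfact_def)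
  qed
  have ab: "a * b = fps_X ^ (m * (2 * n + 2))"
  proof -
    have "nat (int n + 1 - k) + nat (int n + 1 + k) = 2 * n + 2" using k by (simp add: nat_add_distrib[symmetric])
    then show ?thesis unfolding a_def b_def by (metis distrib_left power_add)
  qed
  have aB: "(1 + b) * (a * B) = (1 + b) * w"
  proof (cases "int n + k \<ge> 0")
    case True
    then have "nat (int n + 1 - k) + nat (int n + k) = 2 * n + 1" using k by (simp add: nat_add_distrib[symmetric])
    then have "a * B = w" unfolding a_def B_def w_def by (metis distrib_left power_add)
    then show ?thesis by simp
  next
    case False then show ?thesis using k by (simp add: b_def)
  qed
  have bA: "(1 + a) * (b * A) = (1 + a) * w"
  proof (cases "int n - k \<ge> 0")
    case True
    then have "nat (int n + 1 + k) + nat (int n - k) = 2 * n + 1" using k by (simp add: nat_add_distrib[symmetric])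
    then have "b * A = w" unfolding b_def A_def w_def by (metis distrib_left power_add)
    then show ?thesis by simp
  next
    case False then show ?thesis using k by (simp add: a_def)
  qed
  have h4: "int n - (k - 1) = int n + 1 - k" "int n + (k + 1) = int n + 1 + k"
    by simp_all
  have cancel: "x + (x + y) = y" for x y :: "bit fps"
    by (simp flip: add.assoc)
  have key: "(1 + w) * (1 + a * b)
      = (1 + a) * (1 + b) * (1 + w) + (1 + B) * (1 + b) * a + (1 + A) * (1 + a) * b"
  proof -
    have "(1 + a) * (1 + b) * (1 + w) + (1 + B) * (1 + b) * a + (1 + A) * (1 + a) * b
       = (1 + a) * (1 + b) * (1 + w) + (1 + b) * a + (1 + b) * (a * B) + (1 + a) * b + (1 + a) * (b * A)"
      by (simp add: algebra_simps)
    also have "\<dots> = (1 + w) * (1 + a * b)"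
      unfolding aB bA by (simp add: algebra_simps cancel)
    finally show ?thesis ..
  qed
  have G2: "qfact m (2 * Suc n) = (1 + a * b) * (1 + w) * qfact m (2 * n)"
    using qfact_Suc[of m "2 * n + 1"] qfact_Suc[of m "2 * n"] by (simp add: ab w_def mult_ac)
  have "qbinom m (Suc n) k = (1 + w) * (1 + a * b) * (qfact m (2 * n) * h * h')"
    unfolding qbinom_def G2 by (simp add: h_def h'_def algebra_simps)
  also have "\<dots> = qbinom m n k * (1 + w) + qbinom m n (k - 1) * a + qbinom m n (k + 1) * b"
    unfolding key qbinom_def h1 h2 h3 h4 by (simp add: algebra_simps h_def h'_def)
  finally show ?thesis unfolding a_def b_def w_def .
qed

text \<open>
  A finite form of the triple product. Passing from $n$ to $n+1$ multiplies by
  $1 + q^{2n+1} + X^{mn+a} + X^{mn+m-a}$; the last two terms shift the exponents of the theta series by one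
  index, and the coefficients combine by \<open>qbinom_Suc\<close>.
\<close>
lemma finite_jacobi_triple_product:
  assumes "0 < a" "a < m"
  shows "(\<Prod>j<n. (1 + fps_X ^ (m * j + a)) * (1 + fps_X ^ (m * j + (m - a))))
       = (\<Sum>k = - int n..int n. qbinom m n k * fps_X ^ theta_exponent m a k)"
proof (induction n)
  case 0
  show ?case by (simp add: qbinom_def theta_exponent_def qfact_def inv_qfact_def)
next
  case (Suc n)
  let ?S = "{- int n..int n}" and ?S' = "{- int (Suc n)..int (Suc n)}"
  let ?X = "\<lambda>k. fps_X ^ theta_exponent m a k :: bit fps"
  define u where "u = (fps_X ^ (m * n + a) :: bit fps)"
  define v where "v = (fps_X ^ (m * n + (m - a)) :: bit fps)"
  define w where "w = (fps_X ^ (m * (2 * n + 1)) :: bit fps)"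
  let ?P = "\<Sum>k\<in>?S. qbinom m n k * ?X k"
  have uv: "u * v = w"
    using assms by (simp add: u_def v_def w_def algebra_simps flip: power_add)
  have 1: "?P * (1 + w) = (\<Sum>k\<in>?S'. qbinom m n k * (1 + w) * ?X k)"
  proof -
    have "?P = (\<Sum>k\<in>?S'. qbinom m n k * ?X k)"
      by (rule sum.mono_neutral_left) (auto simp: qbinom_outside)
    then show ?thesis by (simp add: sum_distrib_left sum_distrib_right mult_ac)
  qed
  \<comment> \<open>Shift of the summation index by 1; the terms that enter at the borders vanish.\<close>
  have 2: "?P * u = (\<Sum>k\<in>?S'. qbinom m n (k - 1) * fps_X ^ (m * nat (int n + 1 - k)) * ?X k)"
  proof -
    have "?P * u = (\<Sum>k\<in>?S. qbinom m n k * (fps_X ^ (m * nat (int n - k)) * ?X (k + 1)))"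
      unfolding sum_distrib_right
    proof (rule sum.cong)
      fix k assume k: "k \<in> ?S"
      have "int (theta_exponent m a k + (m * n + a)) = int (m * nat (int n - k) + theta_exponent m a (k + 1))"
        using theta_exponent_step[OF assms, of k] k by (simp add: algebra_simps)
      then have "theta_exponent m a k + (m * n + a) = m * nat (int n - k) + theta_exponent m a (k + 1)" by linarith
      then show "qbinom m n k * ?X k * u = qbinom m n k * (fps_X ^ (m * nat (int n - k)) * ?X (k + 1))"
        unfolding u_def by (metis mult.assoc power_add)
    qed simp
    also have "\<dots> = (\<Sum>k\<in>{- int n + 1..int n + 1}. qbinom m n (k - 1) * fps_X ^ (m * nat (int n + 1 - k)) * ?X k)"
      by (rule sum.reindex_bij_witness[of _ "\<lambda>k. k - 1" "\<lambda>k. k + 1"]) (auto simp: mult_ac)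
    also have "\<dots> = (\<Sum>k\<in>?S'. qbinom m n (k - 1) * fps_X ^ (m * nat (int n + 1 - k)) * ?X k)"
      by (rule sum.mono_neutral_left) (auto simp: qbinom_outside)
    finally show ?thesis .
  qed
  have 3: "?P * v = (\<Sum>k\<in>?S'. qbinom m n (k + 1) * fps_X ^ (m * nat (int n + 1 + k)) * ?X k)"
  proof -
    have "?P * v = (\<Sum>k\<in>?S. qbinom m n k * (fps_X ^ (m * nat (int n + k)) * ?X (k - 1)))"
      unfolding sum_distrib_right
    proof (rule sum.cong)
      fix k assume k: "k \<in> ?S"
      have "int (theta_exponent m a k + (m * n + (m - a))) = int (m * nat (int n + k) + theta_exponent m a (k - 1))"
        using theta_exponent_step[OF assms, of "k - 1"] k assms by (simp add: algebra_simps of_nat_diff)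
      then have "theta_exponent m a k + (m * n + (m - a)) = m * nat (int n + k) + theta_exponent m a (k - 1)" by linarith
      then show "qbinom m n k * ?X k * v = qbinom m n k * (fps_X ^ (m * nat (int n + k)) * ?X (k - 1))"
        unfolding v_def by (metis mult.assoc power_add)
    qed simp
    also have "\<dots> = (\<Sum>k\<in>{- int n - 1..int n - 1}. qbinom m n (k + 1) * fps_X ^ (m * nat (int n + 1 + k)) * ?X k)"
      by (rule sum.reindex_bij_witness[of _ "\<lambda>k. k + 1" "\<lambda>k. k - 1"]) (auto simp: mult_ac algebra_simps)
    also have "\<dots> = (\<Sum>k\<in>?S'. qbinom m n (k + 1) * fps_X ^ (m * nat (int n + 1 + k)) * ?X k)"
      by (rule sum.mono_neutral_left) (auto simp: qbinom_outside)
    finally show ?thesis .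
  qed
  have "(\<Prod>j<Suc n. (1 + fps_X ^ (m * j + a)) * (1 + fps_X ^ (m * j + (m - a)))) = ?P * ((1 + u) * (1 + v))"
    by (simp add: Suc.IH u_def v_def)
  also have "\<dots> = ?P * (1 + w) + ?P * u + ?P * v"
    by (simp add: uv[symmetric] algebra_simps)
  also have "\<dots> = (\<Sum>k\<in>?S'. qbinom m (Suc n) k * ?X k)"
    unfolding 1 2 3 sum.distrib[symmetric]
    by (intro sum.cong refl) (use assms in \<open>simp add: qbinom_Suc w_def ring_distribs\<close>)
  finally show ?case .
qed

lemma agree_qfact:
  assumes "m > 0" "d \<le> j"
  shows "agree d (dprod {k. m dvd k}) (qfact m j)"
proof -
  have "qfact m j = (\<Prod>k\<in>(\<lambda>i. m * i) ` {1..j}. 1 + fps_X ^ k)"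
    using assms by (simp add: qfact_def prod.reindex inj_on_def)
  also have "agree d (dprod {k. m dvd k}) \<dots>"
  proof (rule agree_dprod)
    show "{k. m dvd k} \<inter> {1..<d} \<subseteq> (\<lambda>i. m * i) ` {1..j}"
    proof
      fix k assume k: "k \<in> {k. m dvd k} \<inter> {1..<d}"
      then obtain i where "k = m * i" by auto
      moreover have "i \<le> m * i" using assms by simp
      moreover have "m * i < d" using k \<open>k = m * i\<close> by simp
      ultimately have "i \<le> j" using \<open>d \<le> j\<close> by linarith
      with \<open>k = m * i\<close> show "k \<in> (\<lambda>i. m * i) ` {1..j}" using k assms by (intro image_eqI[of _ _ i]) (auto simp: Suc_le_eq)
    qed
  qed (use assms in auto)
  finally show ?thesis .
qed

text \<open>
  In the limit of the finite form ${2n \brack n+k}_q$ tends to $1/(q;q)_\infty$, and this is cancelled by the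
  factors at the multiples of $m$. Modulo $X^d$ taking $n = 2d$ is enough: a term with $|k| \ge d$ vanishes
  because its exponent is at least $|k|$, and for $|k| < d$ all three $q$-factorials in the binomial
  coefficient have at least $d$ factors and agree with $(q;q)_\infty$. The condition $2a \ne m$ keeps
  the residues $a$ and $m-a$ apart, so that the product runs over a set.
\<close>
lemma jacobi_triple_product:
  assumes a: "0 < a" "a < m" "2 * a \<noteq> m"
  shows "dprod {k. k mod m \<in> {0, a, m - a}} = theta m a"
proof (rule agree_eqI)
  fix d :: nat
  define n :: nat where "n = 2 * d"
  let ?X = "\<lambda>k. fps_X ^ theta_exponent m a k :: bit fps"
  let ?P = "\<Prod>j<n. (1 + fps_X ^ (m * j + a)) * (1 + fps_X ^ (m * j + (m - a))) :: bit fps"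
  let ?D0 = "dprod {k. m dvd k}"
  have m: "m > 0" using a by simp
  define J where "J = (\<lambda>j. m * j + a) ` {..<n} \<union> (\<lambda>j. m * j + (m - a)) ` {..<n}"
  have mod1: "(m * j + a) mod m = a" "(m * j + (m - a)) mod m = m - a" for j
    using a by (simp_all del: Nat.add_diff_assoc add_diff_assoc2)
  have disj: "(\<lambda>j. m * j + a) ` {..<n} \<inter> (\<lambda>j. m * j + (m - a)) ` {..<n} = {}"
  proof (rule ccontr)
    assume "\<not> ?thesis"
    then obtain i j where "m * i + a = m * j + (m - a)" by auto
    then have "a = m - a" using mod1 by metis
    then show False using a by simp
  qed
  have "?P = (\<Prod>k\<in>J. 1 + fps_X ^ k)"
    unfolding J_def using m
    by (subst prod.union_disjoint[OF _ _ disj]) (auto simp: prod.reindex inj_on_def prod.distrib)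
  also have "agree d (dprod {k. k mod m \<in> {a, m - a}}) \<dots>"
  proof (rule agree_dprod)
    show "{k. k mod m \<in> {a, m - a}} \<inter> {1..<d} \<subseteq> J"
    proof
      fix k assume k: "k \<in> {k. k mod m \<in> {a, m - a}} \<inter> {1..<d}"
      have "k div m \<le> k" by simp
      also have "k < d" using k by simp
      finally have "k div m < n" by (simp add: n_def)
      moreover have "k = m * (k div m) + k mod m" by simp
      ultimately show "k \<in> J" using k unfolding J_def by (metis (mono_tags, lifting) IntD1 UnI1 UnI2 image_eqI insertE lessThan_iff mem_Collect_eq singletonD)
    qed
  qed (use a mod1 in \<open>auto simp: J_def simp del: Nat.add_diff_assoc add_diff_assoc2\<close>)
  finally have P: "agree d (dprod {k. k mod m \<in> {a, m - a}}) ?P" .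
  have disj': "{k. m dvd k} \<inter> {k. k mod m \<in> {a, m - a}} = {}"
    using a by auto
  have un: "{k. k mod m \<in> {0, a, m - a}} = {k. m dvd k} \<union> {k. k mod m \<in> {a, m - a}}"
    by auto
  have "dprod {k. k mod m \<in> {0, a, m - a}} = ?D0 * dprod {k. k mod m \<in> {a, m - a}}"
    unfolding un by (rule dprod_Un_disjoint[OF disj'])
  also have "agree d \<dots> (?D0 * ?P)"
    by (intro agree_mult P agree_refl)
  also have "?D0 * ?P = (\<Sum>k = - int n..int n. ?D0 * qbinom m n k * ?X k)"
    unfolding finite_jacobi_triple_product[OF a(1,2)] by (simp add: sum_distrib_left mult.assoc)
  also have "agree d \<dots> (\<Sum>k = - int n..int n. ?X k)"
  proof (rule agree_sum)
    fix k assume k: "k \<in> {- int n..int n}"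
    have t: "\<bar>k\<bar> \<le> int (theta_exponent m a k)" by (rule abs_le_theta_exponent[OF a(1,2)])
    show "agree d (?D0 * qbinom m n k * ?X k) (?X k)"
    proof (cases "\<bar>k\<bar> < int d")
      case False
      then have "d \<le> theta_exponent m a k" using t by linarith
      then show ?thesis
        using agree_X_power[of d "theta_exponent m a k" "?D0 * qbinom m n k :: bit fps"] agree_X_power[of d "theta_exponent m a k" "1 :: bit fps"]
        by (auto intro: agree_trans agree_sym)
    next
      case True
      define i where "i = nat (int n + k)"
      define j where "j = nat (int n - k)"
      have ij: "int n + k = int i" "int n - k = int j" "d \<le> i" "d \<le> j" "d \<le> 2 * n"
        using True by (auto simp: i_def j_def n_def)
      have "agree d (?D0 * qbinom m n k) (qfact m i * (qfact m j * inv_qfact m (int i) * inv_qfact m (int j)))"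
        unfolding qbinom_def ij mult.assoc
        by (intro agree_mult agree_refl agree_qfact agree_trans[OF agree_sym agree_qfact] m ij)
      also have "\<dots> = (qfact m i * inv_qfact m (int i)) * (qfact m j * inv_qfact m (int j))" by (simp add: mult_ac)
      also have "\<dots> = 1" by (simp add: qfact_inverse m)
      finally show ?thesis using agree_mult[OF _ agree_refl[of d "?X k"]] by fastforce
    qed
  qed
  also have "agree d \<dots> (theta m a)"
    unfolding agree_def
  proof (intro allI impI)
    fix i assume "i < d"
    have "(\<Sum>k = - int n..int n. ?X k) $ i = (\<Sum>k = - int n..int n. if theta_exponent m a k = i then 1 else 0)"
      by (simp add: fps_sum_nth fps_X_power_nth eq_commute)
    also have "\<dots> = of_nat (card {k \<in> {- int n..int n}. theta_exponent m a k = i})"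
      by (simp add: sum.If_cases Int_def)
    also have "{k \<in> {- int n..int n}. theta_exponent m a k = i} = {k. theta_exponent m a k = i}"
    proof -
      have "k \<in> {- int n..int n}" if "theta_exponent m a k = i" for k
      proof -
        have "\<bar>k\<bar> \<le> int (theta_exponent m a k)"
          by (rule abs_le_theta_exponent[OF a(1,2)])
        then have "\<bar>k\<bar> \<le> int n" using that \<open>i < d\<close> by (simp add: n_def)
        then show ?thesis by auto
      qed
      then show ?thesis by blast
    qed
    finally show "(\<Sum>k = - int n..int n. ?X k) $ i = theta m a $ i"
      by (simp add: theta_def)
  qed
  finally show "agree d (dprod {k. k mod m \<in> {0, a, m - a}}) (theta m a)" .
qed

section \<open>Sums of two odd squares\<close>

definition odd_reps :: "int \<Rightarrow> (int \<times> int) set" where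
  "odd_reps M = {(s, t). odd s \<and> odd t \<and> s\<^sup>2 + t\<^sup>2 = M}"

text \<open>
  The representations for which the Gaussian integer $s + it$ is not divisible by $2 + i$, because
  $(s+it)(2-i) = (2s+t) + i(2t-s)$.
\<close>
definition prim_reps :: "int \<Rightarrow> (int \<times> int) set" where
  "prim_reps M = {(s, t) \<in> odd_reps M. \<not> 5 dvd 2 * s + t}"

lemma finite_odd_reps [simp]: "finite (odd_reps M)"
proof (rule finite_subset)
  have *: "\<bar>s\<bar> \<le> M" if "s\<^sup>2 + t\<^sup>2 = M" for s t :: int
  proof -
    have "\<bar>s\<bar> \<le> s\<^sup>2" using self_le_power[of "\<bar>s\<bar>" 2] by (cases "s = 0") auto
    then show ?thesis using that zero_le_power2[of t] by linarith
  qed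
  show "odd_reps M \<subseteq> {-M..M} \<times> {-M..M}"
  proof
    fix p assume "p \<in> odd_reps M"
    then obtain s t where p: "p = (s, t)" "s\<^sup>2 + t\<^sup>2 = M" by (auto simp: odd_reps_def)
    then show "p \<in> {-M..M} \<times> {-M..M}" using *[of s t] *[of t s] by auto
  qed
qed simp

lemma five_dvd_other_factor:
  fixes x y M :: int
  assumes "x\<^sup>2 + y\<^sup>2 = 5 * M" "\<not> 5 dvd 2 * x + y"
  obtains s where "2 * x - y = 5 * s"
proof -
  have "(2 * x + y) * (2 * x - y) = 5 * (x\<^sup>2 - M)"
    using assms(1) by (simp add: power2_eq_square algebra_simps)
  then have "5 dvd (2 * x + y) * (2 * x - y)" by simp
  moreover have "prime (5 :: int)" by simp
  ultimately have "5 dvd 2 * x - y" using assms(2) prime_dvd_mult_iff by blast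
  then show thesis using that by blast
qed

text \<open>
  Multiplication by $2 - i$ is a bijection: a Gaussian integer whose norm is divisible by 5 is divisible
  by $2+i$ or $2-i$, and the first is excluded here.
\<close>
lemma card_prim_reps_5: "card (prim_reps (5 * M)) = card (prim_reps M)"
proof (rule bij_betw_same_card[symmetric], rule bij_betwI)
  show "(\<lambda>(s, t). (2 * s + t, 2 * t - s)) \<in> prim_reps M \<rightarrow> prim_reps (5 * M)"
  proof
    fix p assume "p \<in> prim_reps M"
    then obtain s t where p: "p = (s, t)" "odd s" "odd t" "s\<^sup>2 + t\<^sup>2 = M" "\<not> 5 dvd 2 * s + t"
      by (auto simp: prim_reps_def odd_reps_def)
    have "(2 * s + t)\<^sup>2 + (2 * t - s)\<^sup>2 = 5 * M"
      unfolding p(4)[symmetric] by (simp add: power2_eq_square algebra_simps)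
    moreover have "\<not> 5 dvd 2 * (2 * s + t) + (2 * t - s)"
      using p(5) by presburger
    ultimately show "(case p of (s, t) \<Rightarrow> (2 * s + t, 2 * t - s)) \<in> prim_reps (5 * M)"
      using p by (auto simp: prim_reps_def odd_reps_def)
  qed
  show "(\<lambda>(x, y). ((2 * x - y) div 5, (x + 2 * y) div 5)) \<in> prim_reps (5 * M) \<rightarrow> prim_reps M"
  proof
    fix p assume "p \<in> prim_reps (5 * M)"
    then obtain x y where p: "p = (x, y)" "odd x" "odd y" "x\<^sup>2 + y\<^sup>2 = 5 * M" "\<not> 5 dvd 2 * x + y"
      by (auto simp: prim_reps_def odd_reps_def)
    obtain s where s: "2 * x - y = 5 * s" using p(4,5) by (rule five_dvd_other_factor)
    define t where "t = x - 2 * s"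
    have xy: "x = 2 * s + t" "y = 2 * t - s" using s by (auto simp: t_def)
    have "s\<^sup>2 + t\<^sup>2 = M" using p(4) unfolding xy by (simp add: power2_eq_square algebra_simps)
    moreover have "odd s" "odd t" using p(2,3) unfolding xy by simp_all
    moreover have "\<not> 5 dvd 2 * s + t"
    proof
      assume "5 dvd 2 * s + t"
      then have "5 dvd 4 * (2 * s + t) - 5 * s" by (intro dvd_diff dvd_mult dvd_triv_left)
      also have "4 * (2 * s + t) - 5 * s = 2 * x + y" unfolding xy by simp
      finally show False using p(5) by simp
    qed
    ultimately show "(case p of (x, y) \<Rightarrow> ((2 * x - y) div 5, (x + 2 * y) div 5)) \<in> prim_reps M"
      by (simp add: p(1) xy prim_reps_def odd_reps_def)
  qed
  show "(case (case p of (s, t) \<Rightarrow> (2 * s + t, 2 * t - s)) of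
          (x, y) \<Rightarrow> ((2 * x - y) div 5, (x + 2 * y) div 5)) = p" for p :: "int \<times> int"
    by (cases p) (simp add: algebra_simps)
  show "(case (case q of (x, y) \<Rightarrow> ((2 * x - y) div 5, (x + 2 * y) div 5)) of
          (s, t) \<Rightarrow> (2 * s + t, 2 * t - s)) = q" if q: "q \<in> prim_reps (5 * M)" for q
  proof -
    obtain x y where p: "q = (x, y)" "odd x" "odd y" "x\<^sup>2 + y\<^sup>2 = 5 * M" "\<not> 5 dvd 2 * x + y"
      using q by (auto simp: prim_reps_def odd_reps_def)
    obtain s where s: "2 * x - y = 5 * s" using p(4,5) by (rule five_dvd_other_factor)
    then have "y = 2 * x - 5 * s" by simp
    then show ?thesis by (simp add: p(1))
  qed
qed

definition pos_reps :: "int \<Rightarrow> (int \<times> int) set" where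
  "pos_reps M = {(s, t) \<in> odd_reps M. s > 0 \<and> t > 0}"

text \<open>
  Odd numbers are not 0, so the four choices of signs give different representations.
\<close>
lemma card_odd_reps: "card (odd_reps M) = 4 * card (pos_reps M)"
proof -
  have "bij_betw (\<lambda>((s, t), u, v). (u * s, v * t)) (pos_reps M \<times> {1, -1} \<times> {1, -1}) (odd_reps M)"
  proof (rule bij_betwI[where g = "\<lambda>(s, t). ((\<bar>s\<bar>, \<bar>t\<bar>), sgn s, sgn t)"], goal_cases)
    case 1 show ?case by (auto simp: pos_reps_def odd_reps_def)
  next
    case 2
    have "(case p of (s, t) \<Rightarrow> ((\<bar>s\<bar>, \<bar>t\<bar>), sgn s, sgn t)) \<in> pos_reps M \<times> {1, - 1} \<times> {1, - 1}"
      if mem: "p \<in> odd_reps M" for p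
    proof -
      obtain s t where p: "p = (s, t)" "odd s" "odd t" "s\<^sup>2 + t\<^sup>2 = M"
        using mem by (auto simp: odd_reps_def)
      then have "s \<noteq> 0" "t \<noteq> 0" by auto
      then show ?thesis using p by (auto simp: pos_reps_def odd_reps_def sgn_if)
    qed
    then show ?case by blast
  next
    case (3 x) then show ?case by (auto simp: pos_reps_def odd_reps_def)
  next
    case (4 x) show ?case by (cases x) (simp add: sgn_mult_abs)
  qed
  then have "card (odd_reps M) = card (pos_reps M \<times> {1, -1 :: int} \<times> {1, -1 :: int})"
    by (metis bij_betw_same_card)
  then show ?thesis by (simp add: card_cartesian_product)
qed

text \<open>
  Exchanging the two squares pairs off all positive representations except those with $s = t$.
\<close>
lemma odd_card_pos_reps: "odd (card (pos_reps M)) \<longleftrightarrow> (\<exists>x. odd x \<and> M = 2 * x\<^sup>2)"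
proof -
  define L where "L = {(s, t) \<in> pos_reps M. s < t}"
  define E where "E = {(s, t) \<in> pos_reps M. s = t}"
  define R where "R = {(s, t) \<in> pos_reps M. t < s}"
  have fin: "finite (pos_reps M)"
    by (rule finite_subset[OF _ finite_odd_reps[of M]]) (auto simp: pos_reps_def)
  have finL: "finite L" and finR: "finite R" and finE: "finite E"
    by (rule finite_subset[OF _ fin]; auto simp: L_def R_def E_def)+
  have "R = prod.swap ` L"
    by (auto simp: pos_reps_def odd_reps_def image_iff add.commute L_def R_def)
  then have R: "card R = card L" by (simp add: card_image)
  have "pos_reps M = (L \<union> R) \<union> E" by (auto simp: L_def R_def E_def)
  moreover have "card (L \<union> R \<union> E) = card (L \<union> R) + card E"
    using finL finR finE by (intro card_Un_disjoint) (auto simp: L_def R_def E_def)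
  moreover have "card (L \<union> R) = card L + card R"
    using finL finR by (intro card_Un_disjoint) (auto simp: L_def R_def)
  ultimately have "card (pos_reps M) = 2 * card L + card E" using R by simp
  then have "odd (card (pos_reps M)) \<longleftrightarrow> odd (card E)" by simp
  also have "\<dots> \<longleftrightarrow> (\<exists>x. odd x \<and> M = 2 * x\<^sup>2)"
  proof (cases "\<exists>x. odd x \<and> M = 2 * x\<^sup>2")
    case True
    then obtain x where x: "odd x" "M = 2 * x\<^sup>2" by blast
    have "E = {(\<bar>x\<bar>, \<bar>x\<bar>)}"
    proof -
      have "s = \<bar>x\<bar>" if "s > 0" "s\<^sup>2 = x\<^sup>2" for s
        using that by (auto simp: power2_eq_iff)
      moreover have "x \<noteq> 0" using x by auto
      ultimately show ?thesis using x by (auto simp: pos_reps_def odd_reps_def E_def)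
    qed
    then show ?thesis using True by simp
  next
    case False
    then have "E = {}" by (auto simp: pos_reps_def odd_reps_def E_def)
    then show ?thesis using False by simp
  qed
  finally show ?thesis .
qed

lemma four_times_mod_8: "4 * c mod 8 = (if odd c then 4 else (0::nat))"
  by presburger

lemma odd_iff_mod_8: "4 * c = (N::nat) \<Longrightarrow> N mod 8 = (if P then 4 else 0) \<Longrightarrow> odd c \<longleftrightarrow> P"
  using four_times_mod_8[of c] by (auto split: if_splits)

text \<open>
  All factors 5 can be removed by \<open>card_prim_reps_5\<close>. If 5 does not divide $M$, every
  representation is counted, and \<open>card_odd_reps\<close> and \<open>odd_card_pos_reps\<close> apply.
\<close>
lemma card_prim_reps_mod_8:
  assumes "M > 0"
  shows "card (prim_reps M) mod 8 = (if \<exists>v x. odd x \<and> M = 2 * 5 ^ v * x\<^sup>2 then 4 else 0)"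
  using assms
proof (induction "nat M" arbitrary: M rule: less_induct)
  case less
  show ?case
  proof (cases "5 dvd M")
    case True
    then obtain M' where M': "M = 5 * M'" by blast
    have "(\<exists>v x. odd x \<and> M = 2 * 5 ^ v * x\<^sup>2) \<longleftrightarrow> (\<exists>v x. odd x \<and> M' = 2 * 5 ^ v * x\<^sup>2)" (is "?L \<longleftrightarrow> ?R")
    proof
      assume ?L
      then obtain v x where vx: "odd x" "M = 2 * 5 ^ v * x\<^sup>2" by blast
      show ?R
      proof (cases v)
        case 0
        then have "5 dvd 2 * x\<^sup>2" using vx True by simp
        then have "5 dvd x"
          using prime_dvd_mult_iff[of "5::int" 2 "x\<^sup>2"] prime_dvd_power[of "5::int" x 2] by auto
        then obtain y where y: "x = 5 * y" by blast
        then have "M' = 2 * 5 ^ 1 * y\<^sup>2" "odd y" using vx 0 M' by (auto simp: power2_eq_square)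
        then show ?thesis by blast
      next
        case (Suc u)
        then have "M' = 2 * 5 ^ u * x\<^sup>2" using vx M' by simp
        then show ?thesis using vx by blast
      qed
    next
      assume ?R
      then obtain v x where "odd x" "M' = 2 * 5 ^ v * x\<^sup>2" by blast
      then have "M = 2 * 5 ^ Suc v * x\<^sup>2" using M' by simp
      then show ?L using \<open>odd x\<close> by blast
    qed
    then show ?thesis using less.hyps[of M'] less.prems M' by (simp add: card_prim_reps_5)
  next
    case False
    have "\<not> 5 dvd 2 * s + t" if "s\<^sup>2 + t\<^sup>2 = M" for s t
    proof
      assume "5 dvd 2 * s + t"
      then obtain r where "2 * s + t = 5 * r" by blast
      then have "t = 5 * r - 2 * s" by simp
      then have "M = s\<^sup>2 + (5 * r - 2 * s)\<^sup>2" using that by simp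
      also have "\<dots> = 5 * (s\<^sup>2 - 4 * r * s + 5 * r\<^sup>2)" by (simp add: power2_eq_square algebra_simps)
      finally have "M = 5 * (s\<^sup>2 - 4 * r * s + 5 * r\<^sup>2)" .
      then show False using False by simp
    qed
    then have "prim_reps M = odd_reps M" by (auto simp: prim_reps_def odd_reps_def)
    then have c: "card (prim_reps M) = 4 * card (pos_reps M)" by (simp add: card_odd_reps)
    have "(\<exists>v x. odd x \<and> M = 2 * 5 ^ v * x\<^sup>2) \<longleftrightarrow> (\<exists>x. odd x \<and> M = 2 * x\<^sup>2)" (is "?L \<longleftrightarrow> ?R")
    proof
      assume ?L
      then obtain v x where vx: "odd x" "M = 2 * 5 ^ v * x\<^sup>2" by blast
      have "v = 0"
      proof (rule ccontr)
        assume "v \<noteq> 0"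
        then have "5 dvd (5 ^ v :: int)" by simp
        then show False using vx False by (metis dvd_mult dvd_mult2)
      qed
      then show ?R using vx by auto
    next
      assume ?R
      then show ?L by (metis mult.right_neutral power_0)
    qed
    then show ?thesis unfolding c four_times_mod_8 odd_card_pos_reps by simp
  qed
qed

text \<open>
  The nonzero residues of $2s+t$ modulo 5 are permuted cyclically by multiplication of $s+it$ with $i$,
  which multiplies this residue by 3; hence each is taken equally often.
\<close>
definition res_reps :: "int \<Rightarrow> int \<Rightarrow> (int \<times> int) set" where
  "res_reps M r = {(s, t) \<in> odd_reps M. (2 * s + t) mod 5 = r mod 5}"

lemma card_res_reps_le: "card (res_reps M r) \<le> card (res_reps M (3 * r))"
proof (rule card_inj_on_le)
  show "inj_on (\<lambda>(s, t). (- t, s)) (res_reps M r)" by (auto simp: inj_on_def)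
  show "(\<lambda>(s, t). (- t, s)) ` res_reps M r \<subseteq> res_reps M (3 * r)"
  proof clarify
    fix s t assume "(s, t) \<in> res_reps M r"
    then have "odd s" "odd t" "s\<^sup>2 + t\<^sup>2 = M" and *: "(2 * s + t) mod 5 = r mod 5"
      by (auto simp: res_reps_def odd_reps_def)
    moreover have "(2 * (- t) + s) mod 5 = (3 * r) mod 5"
    proof -
      obtain q where "2 * s + t - r = 5 * q" using * unfolding mod_eq_dvd_iff by blast
      then have "2 * (- t) + s - 3 * r = 5 * (3 * q - s - t)" by simp
      then show ?thesis unfolding mod_eq_dvd_iff by (metis dvd_triv_left)
    qed
    moreover have "(- t, s) \<in> odd_reps M"
      using \<open>odd s\<close> \<open>odd t\<close> \<open>s\<^sup>2 + t\<^sup>2 = M\<close> by (simp add: odd_reps_def add.commute)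
    ultimately show "(- t, s) \<in> res_reps M (3 * r)"
      unfolding res_reps_def mem_Collect_eq prod.case by blast
  qed
  show "finite (res_reps M (3 * r))"
    by (rule finite_subset[OF _ finite_odd_reps[of M]]) (auto simp: res_reps_def)
qed

lemma card_prim_reps: "card (prim_reps M) = 4 * card (res_reps M 2)"
proof -
  have fin: "finite (res_reps M r)" for r
    by (rule finite_subset[OF _ finite_odd_reps[of M]]) (auto simp: res_reps_def)
  have cong: "res_reps M r = res_reps M r'" if "r mod 5 = r' mod 5" for r r'
    using that by (simp add: res_reps_def)
  have 1: "card (res_reps M 2) \<le> card (res_reps M 1)"
    using card_res_reps_le[of M 2] cong[of 6 1] by simp
  have 2: "card (res_reps M 1) \<le> card (res_reps M 3)"
    using card_res_reps_le[of M 1] by simp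
  have 3: "card (res_reps M 3) \<le> card (res_reps M 4)"
    using card_res_reps_le[of M 3] cong[of 9 4] by simp
  have 4: "card (res_reps M 4) \<le> card (res_reps M 2)"
    using card_res_reps_le[of M 4] cong[of 12 2] by simp
  have "prim_reps M = (\<Union>r\<in>{1, 2, 3, 4}. res_reps M r)"
  proof -
    have "\<not> 5 dvd n \<longleftrightarrow> n mod 5 = 1 \<or> n mod 5 = 2 \<or> n mod 5 = 3 \<or> n mod 5 = 4" for n :: int
      by presburger
    then show ?thesis by (auto simp: prim_reps_def res_reps_def)
  qed
  also have "card \<dots> = (\<Sum>r\<in>{1, 2, 3, 4}. card (res_reps M r))"
  proof (rule card_UN_disjoint)
    have "res_reps M r \<inter> res_reps M r' = {}" if "r mod 5 \<noteq> r' mod 5" for r r'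
      using that by (auto simp: res_reps_def)
    then show "\<forall>r\<in>{1, 2, 3, 4}. \<forall>r'\<in>{1, 2, 3, 4}. r \<noteq> r' \<longrightarrow> res_reps M r \<inter> res_reps M r' = {}"
      by simp
  qed (auto simp: fin)
  finally show ?thesis using 1 2 3 4 by simp
qed

lemma res_reps_coordinates:
  assumes "odd s" "odd t" "(2 * s + t) mod 5 = 2"
  obtains k l :: int where "2 * s + t + 3 = 10 * k" "2 * t - s + 1 = 10 * l"
proof -
  obtain q where q: "2 * s + t = 5 * q + 2" using assms(3) by (metis mult_div_mod_eq)
  have "odd (2 * s + t)" using assms(2) by simp
  then have "odd q" unfolding q by simp
  then obtain i where i: "q = 2 * i + 1" by (elim oddE)
  obtain j where j: "s = 2 * j + 1" using assms(1) by (elim oddE)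
  have "2 * s + t + 3 = 10 * (i + 1)" using q i by simp
  moreover have "2 * t - s + 1 = 10 * (2 * i + 1 - j)" using q i j by simp
  ultimately show thesis by (rule that)
qed

text \<open>
  The substitution is $s + it = (x+iy)/(2-i)$ for $x = 10k-3$, $y = 10l-1$: completing the squares turns the
  equation into $x^2+y^2 = 5(16n+2)$, and dividing by a factor of norm 5 leaves $s^2+t^2 = 16n+2$. The
  argument so far shows that the number of solutions is odd if and only if $8n+1 = 5^v x^2$ for some $v$ and
  odd $x$; as $5^v x^2 \equiv 5$ modulo 8 for odd $v$, only even $v$ occur.
\<close>
lemma odd_card_quadratic_reps:
  "odd (card {(k, l). 5 * k\<^sup>2 - 3 * k + 5 * l\<^sup>2 - l = 4 * int n}) \<longleftrightarrow> (\<exists>x::int. 8 * int n + 1 = x\<^sup>2)"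
proof -
  let ?S = "{(k, l). 5 * k\<^sup>2 - 3 * k + 5 * l\<^sup>2 - l = 4 * int n}"
  let ?M = "16 * int n + 2"
  have "bij_betw (\<lambda>(k, l). (4 * k - 2 * l - 1, 2 * k + 4 * l - 1)) ?S (res_reps ?M 2)"
  proof (rule bij_betwI[where g = "\<lambda>(s, t). ((2 * s + t + 3) div 10, (2 * t - s + 1) div 10)"], goal_cases)
    case 1
    have "(4 * k - 2 * l - 1)\<^sup>2 + (2 * k + 4 * l - 1)\<^sup>2 = 4 * (5 * k\<^sup>2 - 3 * k + 5 * l\<^sup>2 - l) + 2" for k l :: int
      by (simp add: power2_eq_square algebra_simps)
    moreover have "(2 * (4 * k - 2 * l - 1) + (2 * k + 4 * l - 1)) mod 5 = 2" for k l :: int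
      using mod_mult_self2[of 2 5 "2 * k - 1"] by (simp add: algebra_simps)
    ultimately show ?case by (auto simp: res_reps_def odd_reps_def)
  next
    case 2
    show ?case
    proof
      fix p assume "p \<in> res_reps ?M 2"
      then obtain s t where p: "p = (s, t)" "odd s" "odd t" "s\<^sup>2 + t\<^sup>2 = ?M" "(2 * s + t) mod 5 = 2"
        by (auto simp: res_reps_def odd_reps_def)
      obtain k l where kl: "2 * s + t + 3 = 10 * k" "2 * t - s + 1 = 10 * l"
        using res_reps_coordinates p(2,3,5) by metis
      then have st: "s = 4 * k - 2 * l - 1" "t = 2 * k + 4 * l - 1" by auto
      have "5 * k\<^sup>2 - 3 * k + 5 * l\<^sup>2 - l = 4 * int n"
        using p(4) unfolding st by (simp add: power2_eq_square algebra_simps)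
      then show "(case p of (s, t) \<Rightarrow> ((2 * s + t + 3) div 10, (2 * t - s + 1) div 10)) \<in> ?S"
        by (simp add: p(1) kl)
    qed
  next
    case (3 p) then show ?case by (auto simp: algebra_simps)
  next
    case (4 p)
    then obtain s t where p: "p = (s, t)" "odd s" "odd t" "(2 * s + t) mod 5 = 2"
      by (auto simp: res_reps_def odd_reps_def)
    obtain k l where kl: "2 * s + t + 3 = 10 * k" "2 * t - s + 1 = 10 * l"
      using res_reps_coordinates p(2-4) by metis
    then show ?case by (simp add: p(1))
  qed
  then have "card ?S = card (res_reps ?M 2)" by (rule bij_betw_same_card)
  then have "4 * card ?S = card (prim_reps ?M)" by (simp add: card_prim_reps)
  moreover have "card (prim_reps ?M) mod 8 = (if \<exists>v x. odd x \<and> ?M = 2 * 5 ^ v * x\<^sup>2 then 4 else 0)"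
    by (rule card_prim_reps_mod_8) simp
  ultimately have "odd (card ?S) \<longleftrightarrow> (\<exists>v x. odd x \<and> ?M = 2 * 5 ^ v * x\<^sup>2)"
    by (rule odd_iff_mod_8)
  also have "\<dots> \<longleftrightarrow> (\<exists>x. 8 * int n + 1 = x\<^sup>2)"
  proof
    assume "\<exists>v x. odd x \<and> ?M = 2 * 5 ^ v * x\<^sup>2"
    then obtain v x where "odd x" and M: "?M = 2 * 5 ^ v * x\<^sup>2" by blast
    then have x: "odd x" "8 * int n + 1 = 5 ^ v * x\<^sup>2" by simp_all
    obtain i where i: "x = 2 * i + 1" using x(1) by (elim oddE)
    have "even (i * (i + 1))" by simp
    then obtain j where "i * (i + 1) = 2 * j" by blast
    then have xj: "x\<^sup>2 = 8 * j + 1" by (simp add: i power2_eq_square algebra_simps)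
    have "even v"
    proof (rule ccontr)
      assume "odd v"
      then obtain w where w: "v = 2 * w + 1" by (elim oddE)
      have "(25 :: int) ^ w mod 8 = 1" using power_mod[of "25::int" 8 w] by simp
      then obtain u where "(25 :: int) ^ w = 8 * u + 1"
        by (metis mult_div_mod_eq)
      then have "5 ^ v * x\<^sup>2 = (8 * u + 1) * 5 * (8 * j + 1)"
        by (simp add: w power_mult xj)
      also have "\<dots> = 8 * (40 * u * j + 5 * u + 5 * j) + 5" by (simp add: algebra_simps)
      finally show False using x(2) by presburger
    qed
    then obtain w where "v = 2 * w" by blast
    then have "8 * int n + 1 = (5 ^ w * x)\<^sup>2" using x(2) by (simp add: power_mult_distrib power_mult mult.commute)
    then show "\<exists>x. 8 * int n + 1 = x\<^sup>2" by blast
  next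
    assume "\<exists>x. 8 * int n + 1 = x\<^sup>2"
    then obtain x where x: "8 * int n + 1 = x\<^sup>2" by blast
    have "odd (x\<^sup>2)" unfolding x[symmetric] by simp
    then have "odd x" by simp
    moreover have "?M = 2 * 5 ^ 0 * x\<^sup>2" using x by simp
    ultimately show "\<exists>v x. odd x \<and> ?M = 2 * 5 ^ v * x\<^sup>2" by blast
  qed
  finally show ?thesis .
qed

section \<open>From the analytic generating function to power series modulo 2\<close>

text \<open>
  Integer series are the link between the analytic functions, whose expansions they give in the
  complex numbers, and the series modulo 2.
\<close>
definition cast_fps :: "int fps \<Rightarrow> 'a::comm_ring_1 fps" where
  "cast_fps F = Abs_fps (\<lambda>n. of_int (F $ n))"

lemma cast_fps_nth [simp]: "cast_fps F $ n = of_int (F $ n)"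
  by (simp add: cast_fps_def)
lemma cast_fps_1 [simp]: "cast_fps 1 = 1"
  by (simp add: fps_eq_iff)
lemma cast_fps_mult [simp]: "cast_fps (F * G) = cast_fps F * cast_fps G"
  by (simp add: fps_eq_iff fps_mult_nth)
lemma cast_fps_power [simp]: "cast_fps (F ^ n) = cast_fps F ^ n"
  by (induction n) simp_all
lemma cast_fps_factor [simp]:
  "cast_fps (1 - of_int s * fps_X ^ k) = 1 - of_int s * fps_X ^ k"
  by (simp add: fps_eq_iff flip: fps_of_int)
lemma cast_fps_complex_inject: "(cast_fps F :: complex fps) = cast_fps G \<Longrightarrow> F = G"
  by (simp add: fps_eq_iff)

definition qpoch_partial :: "int \<Rightarrow> nat \<Rightarrow> nat \<Rightarrow> int fps" where
  "qpoch_partial s m N = (\<Prod>j<N. 1 - of_int s * fps_X ^ (m * Suc j))"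

lemma agree_qpoch_partial:
  assumes "m > 0"
  shows "agree N (qpoch_partial s m (N + i)) (qpoch_partial s m N)"
proof (induction i)
  case (Suc i)
  have "agree N (1 - of_int s * fps_X ^ (m * Suc (N + i))) (1 :: int fps)"
  proof -
    have "N + i \<le> m * (N + i)" using assms by simp
    then have "N \<le> m * Suc (N + i)" unfolding mult_Suc_right by linarith
    then have "agree N (of_int s * fps_X ^ (m * Suc (N + i))) (0 :: int fps)" by (rule agree_X_power)
    then show ?thesis by (simp add: agree_def)
  qed
  from agree_mult[OF Suc.IH this] show ?case by (simp add: qpoch_partial_def)
qed simp

text \<open>
  The partial products converge uniformly near 0 and, as power series, coefficient by coefficient;
  the two limits must then correspond. Modulo 2 the sign $s$ is invisible.
\<close>
lemma qpoch_expansion: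
  assumes s: "s \<in> {1, -1 :: int}" and m: "m > 0"
  obtains F where "(\<lambda>q::complex. qpoch (of_int s * q ^ m) (q ^ m)) has_fps_expansion cast_fps F"
    "cast_fps F = dprod {k. m dvd k}"
proof
  define F where "F = Abs_fps (\<lambda>n. qpoch_partial s m (Suc n) $ n)"
  define f where "f = (\<lambda>N (q::complex). \<Prod>j<N. 1 - of_int s * q ^ m * (q ^ m) ^ j)"
  let ?g = "\<lambda>q::complex. qpoch (of_int s * q ^ m) (q ^ m)"
  have F: "agree N F (qpoch_partial s m N)" for N
    unfolding agree_def
  proof (intro allI impI)
    fix i assume "i < N"
    then obtain j where "N = Suc i + j" using less_iff_Suc_add by auto
    then show "F $ i = qpoch_partial s m N $ i"
      using agree_qpoch_partial[OF m, of "Suc i" s j] by (simp add: F_def agree_def)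
  qed
  have ns: "norm (of_int s :: complex) = 1" using s by auto
  have int: "int_series ?g" by (rule qpoch_int_series[OF ns _ m]) simp
  have uni: "uniform_limit (cball 0 (1/2)) f ?g sequentially"
  proof -
    have r: "0 < (1/2::real)" "(1/2::real) < 1" by simp_all
    have "uniformly_convergent_on (cball 0 (1/2)) f"
      unfolding f_def
      by (intro uniformly_convergent_on_prod' qpoch_factors_uniform ns m r) (auto intro!: continuous_intros)
    then obtain l where l: "uniform_limit (cball 0 (1/2)) f l sequentially"
      by (auto simp: uniformly_convergent_on_def)
    have "l q = ?g q" if "q \<in> cball 0 (1/2)" for q
    proof (rule LIMSEQ_unique)
      show "(\<lambda>N. f N q) \<longlonglongrightarrow> l q" using tendsto_uniform_limitI[OF l that] .
      have "norm q < 1" using that by simp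
      then have "convergent_prod (\<lambda>j. 1 - of_int s * q ^ m * (q ^ m) ^ j)"
        by (rule qpoch_convergent[OF ns m])
      then have "(\<lambda>N. \<Prod>j\<le>N. 1 - of_int s * q ^ m * (q ^ m) ^ j) \<longlonglongrightarrow> ?g q"
        unfolding qpoch_def by (rule convergent_prod_LIMSEQ)
      then show "(\<lambda>N. f N q) \<longlonglongrightarrow> ?g q"
        by (simp add: f_def LIMSEQ_lessThan_iff_atMost)
    qed
    with l show ?thesis by (subst uniform_limit_cong'[where g = f and i = l]) auto
  qed
  have exp: "f N has_fps_expansion cast_fps (qpoch_partial s m N)" for N
  proof (induction N)
    case 0
    show ?case by (simp add: f_def qpoch_partial_def)
  next
    case (Suc N)
    have "(\<lambda>q::complex. 1 - of_int s * q ^ (m * Suc N)) has_fps_expansion 1 - fps_const (of_int s) * fps_X ^ (m * Suc N)"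
      by (intro fps_expansion_intros)
    then have "(\<lambda>q::complex. f N q * (1 - of_int s * q ^ (m * Suc N)))
        has_fps_expansion cast_fps (qpoch_partial s m N) * (1 - of_int s * fps_X ^ (m * Suc N))"
      unfolding fps_of_int by (intro has_fps_expansion_mult Suc.IH)
    moreover have "(\<lambda>q::complex. f N q * (1 - of_int s * q ^ (m * Suc N))) = f (Suc N)"
      by (simp add: f_def power_add power_mult mult.assoc)
    moreover have "cast_fps (qpoch_partial s m N) * (1 - of_int s * fps_X ^ (m * Suc N))
        = (cast_fps (qpoch_partial s m (Suc N)) :: complex fps)"
      unfolding qpoch_partial_def prod.lessThan_Suc cast_fps_mult cast_fps_factor ..
    ultimately show ?case by simp
  qed
  have "fps_expansion ?g 0 = cast_fps F"
  proof (rule uniform_limit_imp_fps_expansion_eq)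
    show "(\<lambda>N. cast_fps (qpoch_partial s m N)) \<longlonglongrightarrow> (cast_fps F :: complex fps)"
    proof (rule tendsto_fpsI)
      fix n
      show "\<forall>\<^sub>F N in sequentially. cast_fps (qpoch_partial s m N) $ n = (cast_fps F $ n :: complex)"
        using eventually_gt_at_top[of n] by eventually_elim (use F in \<open>auto simp: agree_def\<close>)
    qed
    show "uniform_limit (ball 0 (1/2)) f ?g sequentially"
      by (rule uniform_limit_on_subset[OF uni]) auto
    show "?g has_fps_expansion fps_expansion ?g 0" by (rule int_series_expansion[OF int])
    show "\<forall>\<^sub>F N in sequentially. f N holomorphic_on ball 0 (1/2)"
      unfolding f_def by (intro always_eventually allI holomorphic_intros)
  qed (use exp in auto)
  then show "?g has_fps_expansion cast_fps F" using int_series_expansion[OF int] by simp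
  show "cast_fps F = dprod {k. m dvd k}"
  proof (rule agree_eqI)
    fix d
    have "agree d (cast_fps F :: bit fps) (cast_fps (qpoch_partial s m d))"
      using F[of d] by (simp add: agree_def)
    also have "cast_fps (qpoch_partial s m N) = qfact m N" for N
    proof (induction N)
      case (Suc N)
      have "(of_int s :: bit fps) = 1" using s bit_fps_diff[of 0 1] by auto
      then have "cast_fps (1 - of_int s * fps_X ^ (m * Suc N)) = 1 + (fps_X ^ (m * Suc N) :: bit fps)"
        unfolding cast_fps_factor by (simp add: bit_fps_diff)
      then show ?case using Suc.IH
        unfolding qpoch_partial_def prod.lessThan_Suc cast_fps_mult by (simp add: qfact_Suc mult.commute)
    qed (simp add: qpoch_partial_def qfact_def)
    also have "agree d (qfact m d) (dprod {k. m dvd k})"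
      by (rule agree_sym[OF agree_qfact[OF m order_refl]])
    finally show "agree d (cast_fps F) (dprod {k. m dvd k})" .
  qed
qed

definition bracelet_fps :: "nat \<Rightarrow> bit fps" where
  "bracelet_fps k = Abs_fps (\<lambda>n. of_int (dots_bracelet k n))"

text \<open>
  The defining equation, cleared of denominators, holds near 0, so it holds for the expansions, hence for the
  integer series and their reductions.
\<close>
lemma bracelet_fps_eq:
  assumes k: "k > 0"
  shows "bracelet_fps k * dprod UNIV ^ (k - 1) * dprod {i. k dvd i} = dprod UNIV"
proof -
  obtain P where P: "(\<lambda>q::complex. qpoch (of_int 1 * q ^ 1) (q ^ 1)) has_fps_expansion cast_fps P"
      "cast_fps P = dprod {i. 1 dvd i}"
    by (rule qpoch_expansion[of 1 1]) auto
  obtain M where M: "(\<lambda>q::complex. qpoch (of_int (- 1) * q ^ 1) (q ^ 1)) has_fps_expansion cast_fps M"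
      "cast_fps M = dprod {i. 1 dvd i}"
    by (rule qpoch_expansion[of "-1" 1]) auto
  obtain K where K: "(\<lambda>q::complex. qpoch (of_int (- 1) * q ^ k) (q ^ k)) has_fps_expansion cast_fps K"
      "cast_fps K = dprod {i. k dvd i}"
    by (rule qpoch_expansion[of "-1" k]) (use k in auto)
  define C where "C = Abs_fps (dots_bracelet k)"
  have ball: "\<forall>\<^sub>F q in nhds 0. q \<in> ball (0::complex) 1"
    by (intro eventually_nhds_in_open) auto
  then have C: "bracelet_gf k has_fps_expansion cast_fps C"
    using dots_bracelet_sums[OF k]
    by (intro has_fps_expansionI) (auto simp: C_def elim!: eventually_mono)
  have "(\<lambda>q. bracelet_gf k q * qpoch q q ^ (k - 1) * qpoch (- (q ^ k)) (q ^ k))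
      has_fps_expansion cast_fps C * cast_fps P ^ (k - 1) * cast_fps K"
    using P(1) K(1) by (intro has_fps_expansion_mult has_fps_expansion_power C) simp_all
  note e = this
  have ev: "\<forall>\<^sub>F q in nhds 0. bracelet_gf k q * qpoch q q ^ (k - 1) * qpoch (- (q ^ k)) (q ^ k) = qpoch (- q) q"
    using ball
  proof eventually_elim
    case (elim q)
    then have "qpoch q q \<noteq> 0" "qpoch (- (q ^ k)) (q ^ k) \<noteq> 0"
      using qpoch_nz[of 1 1 q] qpoch_nz[of "-1" k q] k by simp_all
    then show ?case by (simp add: bracelet_gf_def)
  qed
  have "(\<lambda>q. qpoch (- q) q) has_fps_expansion cast_fps C * cast_fps P ^ (k - 1) * cast_fps K"
    by (rule iffD1[OF has_fps_expansion_cong[OF ev refl] e])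
  moreover have "(\<lambda>q::complex. qpoch (- q) q) has_fps_expansion cast_fps M"
    using M(1) by simp
  ultimately have "cast_fps C * cast_fps P ^ (k - 1) * cast_fps K = (cast_fps M :: complex fps)"
    by (rule fps_expansion_unique_complex)
  then have "C * P ^ (k - 1) * K = M"
    by (intro cast_fps_complex_inject) simp
  then have "cast_fps C * cast_fps P ^ (k - 1) * cast_fps K = (cast_fps M :: bit fps)"
    by (simp flip: cast_fps_mult cast_fps_power)
  moreover have "cast_fps C = bracelet_fps k"
    by (simp add: fps_eq_iff C_def bracelet_fps_def)
  ultimately show ?thesis using P(2) M(2) K(2) by simp
qed

section \<open>Theta series as products, and the even part of the generating function\<close>

lemma of_nat_bit_eq: "(of_nat a :: bit) = of_nat b" if "odd a \<longleftrightarrow> odd b"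
proof -
  have "(of_nat c :: bit) = (if odd c then 1 else 0)" for c
    by (induction c) auto
  then show ?thesis using that by simp
qed

text \<open>
  From $8(2k^2-k)+1 = (4k-1)^2$: the exponents are pairwise different, and every odd square occurs, since
  one of $x$ and $-x$ is $-1$ modulo 4.
\<close>
lemma theta_4_1_odd: "odd (card {k. theta_exponent 4 1 k = n}) \<longleftrightarrow> (\<exists>x::int. 8 * int n + 1 = x\<^sup>2)"
proof -
  have iff: "theta_exponent 4 1 k = n \<longleftrightarrow> (4 * k - 1)\<^sup>2 = 8 * int n + 1" for k
  proof -
    have "(4 * k - 1)\<^sup>2 = 8 * int (theta_exponent 4 1 k) + 1"
      using theta_exponent_double[of 1 4 k] by (simp add: power2_eq_square algebra_simps)
    then show ?thesis by auto
  qed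
  show ?thesis
  proof (cases "\<exists>k. theta_exponent 4 1 k = n")
    case True
    then obtain k where k: "theta_exponent 4 1 k = n" by blast
    have "k' = k" if "theta_exponent 4 1 k' = n" for k'
    proof -
      have "(4 * k' - 1)\<^sup>2 = (4 * k - 1)\<^sup>2" using iff k that by simp
      then have "4 * k' - 1 = 4 * k - 1 \<or> 4 * k' - 1 = - (4 * k - 1)" by (simp add: power2_eq_iff)
      then show ?thesis by presburger
    qed
    then have "{k. theta_exponent 4 1 k = n} = {k}" using k by blast
    moreover have "\<exists>x::int. 8 * int n + 1 = x\<^sup>2" using iff k by metis
    ultimately show ?thesis by simp
  next
    case False
    have "8 * int n + 1 \<noteq> x\<^sup>2" for x
    proof
      assume x: "8 * int n + 1 = x\<^sup>2"
      have "odd (x\<^sup>2)" unfolding x[symmetric] by simp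
      then have "odd x" by simp
      then have "(\<exists>k. x = 4 * k - 1) \<or> (\<exists>k. - x = 4 * k - 1)" by presburger
      then obtain k where "(4 * k - 1)\<^sup>2 = x\<^sup>2" by (metis power2_minus)
      then show False using False iff x by simp
    qed
    then show ?thesis using False by simp
  qed
qed

lemma even_part_theta: "even_part (theta 5 1 * theta 5 2) = theta 4 1"
proof (rule fps_ext)
  fix n
  have "theta_exponent 5 1 k + theta_exponent 5 2 l = 2 * n \<longleftrightarrow> 5 * k\<^sup>2 - 3 * k + 5 * l\<^sup>2 - l = 4 * int n" for k l
  proof -
    have "2 * int (theta_exponent 5 1 k + theta_exponent 5 2 l) = 5 * k\<^sup>2 - 3 * k + 5 * l\<^sup>2 - l"
      using theta_exponent_double[of 1 5 k] theta_exponent_double[of 2 5 l] by (simp add: power2_eq_square algebra_simps)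
    then have "5 * k\<^sup>2 - 3 * k + 5 * l\<^sup>2 - l = 4 * int n
        \<longleftrightarrow> int (theta_exponent 5 1 k + theta_exponent 5 2 l) = int (2 * n)" by auto
    then show ?thesis unfolding of_nat_eq_iff by blast
  qed
  then have "odd (card {(k, l). theta_exponent 5 1 k + theta_exponent 5 2 l = 2 * n}) \<longleftrightarrow> odd (card {k. theta_exponent 4 1 k = n})"
    using odd_card_quadratic_reps[of n] unfolding theta_4_1_odd by simp
  then have "(of_nat (card {(k, l). theta_exponent 5 1 k + theta_exponent 5 2 l = 2 * n}) :: bit) = of_nat (card {k. theta_exponent 4 1 k = n})"
    by (rule of_nat_bit_eq)
  then show "even_part (theta 5 1 * theta 5 2) $ n = theta 4 1 $ n"
    unfolding even_part_def fps_nth_Abs_fps by (subst theta_mult_nth) (simp_all add: theta_def)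
qed

text \<open>
  The residues 0, 1, 4 and 0, 2, 3 modulo 5 together give all numbers once, and the multiples of 5 twice.
\<close>
lemma theta_5_prod: "theta 5 1 * theta 5 2 = dprod UNIV * dprod {k. 5 dvd k}"
proof -
  have "{k. k mod 5 \<in> {0, 1, 5 - 1}} \<union> {k. k mod 5 \<in> {0, 2, 5 - 2}} = (UNIV :: nat set)" by auto
  moreover have "{k. k mod 5 \<in> {0, 1, 5 - 1}} \<inter> {k. k mod 5 \<in> {0, 2, 5 - 2}} = {k. (5::nat) dvd k}" by auto
  moreover have "dprod {k. k mod 5 \<in> {0, 1, 5 - 1}} = theta 5 1" "dprod {k. k mod 5 \<in> {0, 2, 5 - 2}} = theta 5 2"
    by (rule jacobi_triple_product; simp)+
  ultimately show ?thesis
    using dprod_mult[of "{k. k mod 5 \<in> {0, 1, 5 - 1}}" "{k. k mod 5 \<in> {0, 2, 5 - 2}}"] by (simp only:)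
qed

text \<open>
  With $g = \prod (1+X^n)$ over odd $n$, the theta series is $g f_4$. Here $g f_2 = f_1$, and repeated
  squaring gives $f_2 = f_1^2$ and $f_4 = f_2^2$; so $g f_4 = (g f_2) f_2 = f_1^3$.
\<close>
lemma theta_4_1: "theta 4 1 = dprod UNIV ^ 3"
proof -
  have even: "dprod UNIV ^ 2 = dprod {k. even k}"
    unfolding dprod_square by (rule arg_cong[of _ _ dprod]) auto
  have four: "dprod {k. even k} ^ 2 = dprod {k. 4 dvd k}"
    unfolding dprod_square by (rule arg_cong[of _ _ dprod]) (auto simp: image_iff elim!: dvdE)
  have "dprod {k. odd k} * dprod {k. even k} = dprod ({k. odd k} \<union> {k. even k})"
    by (rule dprod_Un_disjoint[symmetric]) auto
  also have "{k. odd k} \<union> {k. even k} = (UNIV :: nat set)" by auto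
  finally have odd: "dprod {k. odd k} * dprod UNIV ^ 2 = dprod UNIV" by (simp add: even)
  have "{k. k mod 4 \<in> {0, 1, 4 - 1}} = {k. odd k} \<union> {k. 4 dvd (k::nat)}" by auto presburger+
  then have "theta 4 1 = dprod ({k. odd k} \<union> {k. 4 dvd k})"
    using jacobi_triple_product[of 1 4] by simp
  also have "\<dots> = dprod {k. odd k} * dprod {k. 4 dvd k}"
    by (rule dprod_Un_disjoint) auto
  also have "\<dots> = (dprod {k. odd k} * dprod UNIV ^ 2) * dprod UNIV ^ 2"
    unfolding four[symmetric] even[symmetric] by (simp add: power2_eq_square mult_ac)
  also have "\<dots> = dprod UNIV ^ 3" unfolding odd by (simp add: power2_eq_square power3_eq_cube)
  finally show ?thesis .
qed

lemma theta_3_1: "theta 3 1 = dprod UNIV"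
proof -
  have "{k. k mod 3 \<in> {0, 1, 3 - 1}} = (UNIV :: nat set)" by auto
  then show ?thesis using jacobi_triple_product[of 1 3] by simp
qed

lemma even_part_bracelet: "even_part (bracelet_fps 5) * dprod {k. 5 dvd k} = theta 3 1"
proof -
  define f where "f = dprod UNIV"
  define g where "g = dprod {k. 5 dvd k}"
  have nz: "f \<noteq> 0" by (simp add: f_def)
  have "f * (bracelet_fps 5 * f ^ 3 * g) = f * 1"
    using bracelet_fps_eq[of 5] by (simp add: f_def g_def eval_nat_numeral mult_ac)
  then have "bracelet_fps 5 * f ^ 3 * g = 1" using nz by simp
  then have "bracelet_fps 5 * (f ^ 2 * g) ^ 2 = f * g"
    by (simp add: eval_nat_numeral mult_ac)
  then have "even_part (bracelet_fps 5) * (f ^ 2 * g) = even_part (f * g)"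
    by (metis even_part_mult_square)
  also have "\<dots> = f ^ 3"
    unfolding f_def g_def theta_5_prod[symmetric] even_part_theta by (rule theta_4_1)
  finally have "even_part (bracelet_fps 5) * (f ^ 2 * g) = f ^ 3" .
  then have "f ^ 2 * (even_part (bracelet_fps 5) * g) = f ^ 2 * f"
    by (simp add: eval_nat_numeral mult_ac)
  then have "even_part (bracelet_fps 5) * g = f" using nz by simp
  then show ?thesis unfolding f_def g_def theta_3_1 .
qed

lemma dprod_multiples_nth:
  assumes "m > 0" "\<not> m dvd n"
  shows "dprod {k. m dvd k} $ n = 0"
proof -
  have "qfact m j $ n = 0" if "\<not> m dvd n" for j n
    using that
  proof (induction j arbitrary: n)
    case (Suc j)
    have "\<not> m dvd n - m * Suc j" if "n \<ge> m * Suc j"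
      using Suc.prems that by (metis dvd_diffD dvd_triv_left)
    then show ?case using Suc
      by (auto simp: qfact_Suc ring_distribs fps_X_power_mult_nth simp del: mult_Suc_right)
  qed (use assms in \<open>auto simp: qfact_def intro!: gr0I\<close>)
  then show ?thesis
    using agree_qfact[OF assms(1), of "Suc n" "Suc n"] assms(2) by (simp add: agree_def)
qed

text \<open>
  Division by a series in $X^m$ with constant coefficient 1 does not mix the residue classes of the
  exponents modulo $m$.
\<close>
lemma quotient_nth_eq_0:
  assumes "F * K = (H :: bit fps)" "K $ 0 = 1" "\<And>i. \<not> m dvd i \<Longrightarrow> K $ i = 0"
    and "\<And>i. i mod m = r \<Longrightarrow> H $ i = 0" and "n mod m = r"
  shows "F $ n = 0"
  using assms(5)
proof (induction n rule: less_induct)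
  case (less n)
  have "0 = (\<Sum>i\<in>{0..n}. F $ i * K $ (n - i))"
    using assms(1,4) less.prems by (metis fps_mult_nth)
  also have "\<dots> = (\<Sum>i\<in>{n}. F $ i * K $ (n - i))"
  proof (rule sum.mono_neutral_right)
    show "\<forall>i\<in>{0..n} - {n}. F $ i * K $ (n - i) = 0"
    proof
      fix i assume i: "i \<in> {0..n} - {n}"
      show "F $ i * K $ (n - i) = 0"
      proof (cases "m dvd n - i")
        case True
        then have "i mod m = r" using less.prems i mod_eq_dvd_iff_nat[of i n m] by simp
        then show ?thesis using less.IH[of i] i by simp
      qed (simp add: assms(3))
    qed
  qed auto
  also have "\<dots> = F $ n * K $ (n - n)"
    by (rule trans[OF sum.insert]) simp_all
  finally show ?case using assms(2) by simp
qed

text \<open>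
  The pentagonal numbers $(3k^2-k)/2$ are 0, 1 or 2 modulo 5, as the five residues of $k$ show.
\<close>
lemma theta_3_1_nth:
  assumes "n mod 5 = 3 \<or> n mod 5 = 4"
  shows "theta 3 1 $ n = 0"
proof -
  have "theta_exponent 3 1 k \<noteq> n" for k
  proof
    assume k: "theta_exponent 3 1 k = n"
    have "2 * int n = 3 * (k * k) - k"
      using theta_exponent_double[of 1 3 k] k by (simp add: algebra_simps)
    then have eq: "(2 * int n) mod 5 = (3 * ((k mod 5) * (k mod 5)) - k mod 5) mod 5"
      by (simp only:) (intro mod_diff_cong mod_mult_cong mod_mod_trivial[symmetric] refl)
    have "k mod 5 \<in> {0, 1, 2, 3, 4}" by auto
    then have "(2 * int n) mod 5 \<in> {0, 2, 4}" unfolding eq by auto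
    moreover have "(2 * int n) mod 5 = (2 * (int n mod 5)) mod 5" by (simp add: mod_simps)
    moreover have "int n mod 5 = 3 \<or> int n mod 5 = 4" using assms by presburger
    ultimately show False by auto
  qed
  then show ?thesis by (simp add: theta_def)
qed

lemma bracelet_even:
  assumes "n mod 5 = 3 \<or> n mod 5 = 4"
  shows "even (dots_bracelet 5 (2 * n))"
proof -
  have "even_part (bracelet_fps 5) $ n = 0"
    using even_part_bracelet _ dprod_multiples_nth _ refl
  proof (rule quotient_nth_eq_0)
    show "theta 3 1 $ i = 0" if "i mod 5 = n mod 5" for i
      using assms that by (intro theta_3_1_nth) simp
  qed simp_all
  then have "(of_int (dots_bracelet 5 (2 * n)) :: bit) = 0"
    by (simp add: even_part_def bracelet_fps_def)
  moreover have "(of_int c :: bit) = 0 \<Longrightarrow> even c" for c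
    by (cases "even c") (auto elim!: oddE)
  ultimately show ?thesis by blast
qed

theorem theorem2p1:
  fixes n :: nat
  shows "[dots_bracelet 5 (10 * n + 6) = 0] (mod 2) \<and> [dots_bracelet 5 (10 * n + 8) = 0] (mod 2)"
proof -
  have "even (dots_bracelet 5 (2 * (5 * n + 3)))" "even (dots_bracelet 5 (2 * (5 * n + 4)))"
    by (rule bracelet_even; simp)+
  then show ?thesis by (simp add: cong_0_iff)
qed

end
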